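(* Let $(\delta_p)_{p\ge1}$ be a sequence of real numbers with $\delta_p\ge0$ for all $p$ and $\sum_{p=1}^{+\infty}\delta_p=+\infty$. Let $M\in\mathcal{LC}$ be the sequence given by $\mu_p=\exp\left(\sum_{j=1}^p\delta_j\right)$, $p\ge1$, i.e. $M_0=1$ and $M_p=\prod_{i=1}^p\mu_i$. (i) If $\sup_{p\ge1}\delta_p=+\infty$ (which contradicts $(\mathrm{mg})$ for $M$), then there does not exist a strictly increasing sequence of positive integers which is a sequence of Lusky numbers for $M$. (ii) If $\limsup_{p\to+\infty}\delta_p<+\infty$, then each sequence $(a_j)_{j\ge1}$ of Lusky numbers for $M$ satisfies $$\sup_{j\ge1}\delta_{a_{j+1}+1}(a_{j+1}-a_j)<+\infty.$$ In particular, if $\liminf_{p\to+\infty}\delta_p>0$, then $\sup_{j\ge1}(a_{j+1}-a_j)<+\infty$, i.e. there is $C\ge2$ with $2\le a_{j+1}-a_j\le C$ for all $j\ge1$, or equivalently the space $H^\infty_{v_{M,c}}(\mathbb{C})$ ($c>0$) is solid. (iii) If there exist numbers $0<d_1\le d_2<+\infty$ such that $d_1\le\delta_p\le d_2$ for all $p\ge1$, then every sequence of nonnegative integers $(a_j)_{j\ge1}$ satisfying $C_1\le a_{j+1}-a_j\le C_2$ for some $2\le C_1\le C_2$ and all $j\ge1$ is a sequence of Lusky numbers for $M$, provided that $$2\le d_1C_1(1+C_1)\qquad\text{and}\qquad1+\frac{d_2C_2(C_2-1)}{2}\le d_1C_1(C_1-1).$$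
   Context: $\mathbb{N}=\{0,1,2,\dots\}$. For a sequence $M=(M_p)_{p\in\mathbb{N}}$ of positive reals put $\mu_p:=M_p/M_{p-1}$ for $p\ge1$ and $\mu_0:=1$. $\mathcal{LC}$ is the set of all such $M$ with $M_0=1\le M_1$, $M_p^2\le M_{p-1}M_{p+1}$ for all $p\ge1$, and $\lim_{p\to\infty}(M_p)^{1/p}=+\infty$. $M$ has $(\mathrm{mg})$ (moderate growth) if there is $C\ge1$ with $M_{j+k}\le C^{j+k}M_jM_k$ for all $j,k\in\mathbb{N}$. For integers $0\le k<l$, $$A_M(k,l):=\frac{(\mu_{l+1})^{l-k}}{\mu_{k+1}\cdots\mu_l},\qquad B_M(k,l):=\frac{\mu_{k+1}\cdots\mu_l}{(\mu_{k+1})^{l-k}}.$$ A strictly increasing sequence of nonnegative integers $(a_j)_{j\ge1}$ is called a sequence of Lusky numbers for $M$ if there exist constants $K\ge b>2$ such that for all $j\ge1$: $b\le\min\{A_M(a_j,a_{j+1}),B_M(a_j,a_{j+1})\}\le\max\{A_M(a_j,a_{j+1}),B_M(a_j,a_{j+1})\}\le K$. With $\omega_M(t):=\sup_{p\in\mathbb{N}}\log(t^p/M_p)$ for $t>0$, $\omega_M(0):=0$, and $v_{M,c}(r):=\exp(-\omega_M(cr))$, let $H^{\infty}_{v_{M,c}}(\mathbb{C}):=\{f \text{ entire}:\ \sup_{z\in\mathbb{C}}|f(z)|v_{M,c}(|z|)<+\infty\}$, where entire functions are identified with their sequences of Taylor coefficients. A vector space $A$ of complex sequences is solid if $(a_j)_j\in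 A$ and $|b_j|\le|a_j|$ for all $j$ imply $(b_j)_j\in A$. *)

theory Defs
  imports "HOL-Complex_Analysis.Complex_Analysis"
begin

definition quot_seq :: "(nat \<Rightarrow> real) \<Rightarrow> nat \<Rightarrow> real" where
  "quot_seq M p = (if p = 0 then 1 else M p / M (p - 1))"

definition LC :: "(nat \<Rightarrow> real) set" where
  "LC = {M. (\<forall>p. M p > 0) \<and> M 0 = 1 \<and> 1 \<le> M 1
          \<and> (\<forall>p\<ge>1. (M p)\<^sup>2 \<le> M (p - 1) * M (p + 1))
          \<and> filterlim (\<lambda>p. M p powr (1 / real p)) at_top sequentially}"

definition moderate_growth :: "(nat \<Rightarrow> real) \<Rightarrow> bool" where
  "moderate_growth M \<longleftrightarrow> (\<exists>C\<ge>1. \<forall>j k. M (j + k) \<le> C ^ (j + k) * M j * M k)"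

definition lusky_A :: "(nat \<Rightarrow> real) \<Rightarrow> nat \<Rightarrow> nat \<Rightarrow> real" where
  "lusky_A M k l = quot_seq M (l + 1) ^ (l - k) / (\<Prod>i=k+1..l. quot_seq M i)"

definition lusky_B :: "(nat \<Rightarrow> real) \<Rightarrow> nat \<Rightarrow> nat \<Rightarrow> real" where
  "lusky_B M k l = (\<Prod>i=k+1..l. quot_seq M i) / quot_seq M (k + 1) ^ (l - k)"

text \<open>Sequences indexed by the positive integers are functions on \<^typ>\<open>nat\<close> whose value
  at 0 is never used.\<close>

definition lusky_numbers :: "(nat \<Rightarrow> real) \<Rightarrow> (nat \<Rightarrow> nat) \<Rightarrow> bool" where
  "lusky_numbers M a \<longleftrightarrow>
     strict_mono_on {1..} a \<and>
     (\<exists>K b. K \<ge> b \<and> b > 2 \<and>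
        (\<forall>j\<ge>1. b \<le> min (lusky_A M (a j) (a (j + 1))) (lusky_B M (a j) (a (j + 1)))
             \<and> max (lusky_A M (a j) (a (j + 1))) (lusky_B M (a j) (a (j + 1))) \<le> K))"

text \<open>The real supremum is the intended one for \<open>M \<in> LC\<close>: since the \<open>p\<close>-th roots of
  \<open>M p\<close> tend to infinity, the set of values is bounded above.\<close>

definition omega :: "(nat \<Rightarrow> real) \<Rightarrow> real \<Rightarrow> real" where
  "omega M t = (if t > 0 then (SUP p. ln (t ^ p / M p)) else 0)"

definition weight :: "(nat \<Rightarrow> real) \<Rightarrow> real \<Rightarrow> real \<Rightarrow> real" where
  "weight M c r = exp (- omega M (c * r))"

definition H_infty :: "(real \<Rightarrow> real) \<Rightarrow> (complex \<Rightarrow> complex) set" where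
  "H_infty v = {f. f holomorphic_on UNIV \<and> bdd_above (range (\<lambda>z. norm (f z) * v (norm z)))}"

definition taylor_coeffs :: "(complex \<Rightarrow> complex) \<Rightarrow> nat \<Rightarrow> complex" where
  "taylor_coeffs f n = (deriv ^^ n) f 0 / fact n"

definition solid :: "(nat \<Rightarrow> complex) set \<Rightarrow> bool" where
  "solid A \<longleftrightarrow> (\<forall>a b. a \<in> A \<longrightarrow> (\<forall>j. norm (b j) \<le> norm (a j)) \<longrightarrow> b \<in> A)"

end

theory Submission imports Defs begin

text \<open>
  Everything is expressed through \<open>S n = \<delta>\<^sub>1 + \<dots> + \<delta>\<^sub>n\<close>, the logarithm of \<open>\<mu>\<^sub>n\<close>. For \<open>k < l\<close>, the logarithm of
  \<open>A\<^sub>M(k,l)\<close> is the sum of \<open>S (l + 1) - S i\<close> and that of \<open>B\<^sub>M(k,l)\<close> is the sum of \<open>S i - S (k + 1)\<close>, over \<open>k < i \<le> l\<close>.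
  All summands are nonnegative, so a bound on such a sum bounds each increment of \<open>S\<close> that it covers.
  Hence Lusky numbers force \<open>\<delta>\<close> to be bounded (the blocks between them cover all large indices), and
  the increment after a block, which occurs in every summand, is at most a constant divided by the
  length of the block. Moderate growth bounds \<open>\<delta>\<close> as well. If \<open>\<delta>\<close> lies between two positive
  bounds, the sums are compared with triangular numbers.

  The analytic core is that, for Lusky numbers \<open>a\<close>, the space of entire functions is solid exactly if the
  gaps of \<open>a\<close> are bounded. By Cauchy's estimate the coefficients of a function in the space are at most a
  constant times \<open>c ^ n / M n\<close>. Bounded gaps and \<open>B\<^sub>M > 2\<close> make \<open>S\<close> grow by a fixed amount over every window of
  some fixed length; then the series of the terms \<open>t ^ n / M n\<close> is dominated, uniformly in \<open>t\<close>, by its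
  largest term \<open>exp (omega M t)\<close>, and the bound on the moduli of the coefficients characterises the space
  (\<open>sum_le_exp_omega_if_separated\<close>, \<open>solid_if_sum_le_exp_omega\<close>). A positive lower limit of \<open>\<delta>\<close> gives the same
  growth of \<open>S\<close> directly.

  Conversely, suppose that the gaps are unbounded. On a block from \<open>k\<close> to \<open>l\<close> the bound on \<open>B\<^sub>M(k,l)\<close> makes all terms
  \<open>t ^ n / M n\<close> with \<open>k \<le> n \<le> l\<close> comparable at \<open>t = \<mu>\<^bsub>k+1\<^esub>\<close>, so that a polynomial with frequencies in the block and
  bounded by a constant times \<open>exp (omega M t)\<close> on the circle of radius \<open>t\<close> is bounded in the same way
  in the whole plane, by the maximum principle. Polynomials with unimodular coefficients that
  are much smaller on the circle than the number of their coefficients, placed in longer and longer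
  blocks, then sum to a function of the space that leaves it when its coefficients are replaced by
  their moduli (\<open>exists_flat_unimodular_polynomial\<close>, \<open>norm_block_le_exp_omega\<close>, \<open>not_solid_if_long_blocks\<close>).
\<close>

section \<open>Polynomials that are flat on the unit circle\<close>

text \<open>The sum of the moduli of the coefficients is 3, but after division by \<open>z\<close> the outer terms add up to the
  real number \<open>z + 1/z\<close>, which is orthogonal to the imaginary middle term.\<close>

lemma norm_trinomial_le_on_circle:
  fixes z :: complex
  assumes "norm z = 1"
  shows "norm (1 + \<i> * z + z\<^sup>2) \<le> sqrt 5"
proof -
  have "z * cnj z = 1"
    using assms by (simp add: complex_norm_square[symmetric])
  then have "1 + \<i> * z + z\<^sup>2 = z * ((z + cnj z) + \<i>)"
    by (simp add: algebra_simps power2_eq_square)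
  also have "(z + cnj z) + \<i> = Complex (2 * Re z) 1"
    by (simp add: complex_eq_iff)
  finally have "norm (1 + \<i> * z + z\<^sup>2) = sqrt (4 * (Re z)\<^sup>2 + 1)"
    using assms by (simp add: norm_mult complex_norm power_mult_distrib)
  moreover have "(Re z)\<^sup>2 \<le> 1"
    using abs_Re_le_cmod[of z] assms by (simp add: abs_square_le_1)
  ultimately show ?thesis
    by simp
qed

text \<open>In the product of the trinomials in \<open>z, z\<^sup>3, z\<^sup>9, \<dots>\<close> no two monomials collide, so that its coefficients
  stay unimodular while the bounds on the circle multiply. So the sum of the moduli of the
  coefficients, \<open>3 ^ n\<close>, exceeds the maximum on the circle by a factor of at least \<open>(3 / sqrt 5) ^ n\<close>. This is what defeats solidity.\<close>

lemma exists_flat_unimodular_polynomial: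
  "\<exists>e :: nat \<Rightarrow> complex. (\<forall>m. norm (e m) = 1) \<and>
     (\<forall>z. norm z = 1 \<longrightarrow> norm (\<Sum>m<3 ^ n. e m * z ^ m) \<le> sqrt 5 ^ n)"
proof (induction n)
  case 0
  show ?case by (intro exI[of _ "\<lambda>_. 1"]) auto
next
  case (Suc n)
  then obtain e :: "nat \<Rightarrow> complex" where e: "\<And>m. norm (e m) = 1"
    and flat: "\<And>z. norm z = 1 \<Longrightarrow> norm (\<Sum>m<3 ^ n. e m * z ^ m) \<le> sqrt 5 ^ n"
    by blast
  define q :: "nat \<Rightarrow> complex" where "q r = (if r = 1 then \<i> else 1)" for r
  define e' where "e' m = q (m mod 3) * e (m div 3)" for m
  have "norm (\<Sum>m<3 ^ Suc n. e' m * z ^ m) \<le> sqrt 5 ^ Suc n" if z: "norm z = 1" for z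
  proof -
    \<comment> \<open>The new polynomial is the trinomial in \<open>z\<close> times the old polynomial in \<open>z\<^sup>3\<close>.\<close>
    have "(\<Sum>m<3 ^ Suc n. e' m * z ^ m) = (\<Sum>m<3 ^ n. \<Sum>i = m * 3..<m * 3 + 3. e' i * z ^ i)"
      by (subst sum.nat_group) (simp add: mult.commute)
    also have "\<dots> = (\<Sum>m<3 ^ n. (1 + \<i> * z + z\<^sup>2) * (e m * (z ^ 3) ^ m))"
    proof (rule sum.cong[OF refl])
      fix m :: nat
      have set: "{m * 3..<m * 3 + 3} = {3 * m, 3 * m + 1, 3 * m + 2}"
        by auto
      have mod: "(3 * m + 1) mod 3 = 1" "(3 * m + 2) mod 3 = 2"
        "(3 * m + 1) div 3 = m" "(3 * m + 2) div 3 = m"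
        by presburger+
      have e': "e' (3 * m) = e m" "e' (3 * m + 1) = \<i> * e m" "e' (3 * m + 2) = e m"
        unfolding e'_def q_def mod by simp_all
      have "(\<Sum>i = m * 3..<m * 3 + 3. e' i * z ^ i)
          = e' (3 * m) * z ^ (3 * m) + e' (3 * m + 1) * z ^ (3 * m + 1) + e' (3 * m + 2) * z ^ (3 * m + 2)"
        unfolding set by (simp add: add.assoc)
      also have "\<dots> = (1 + \<i> * z + z\<^sup>2) * (e m * (z ^ 3) ^ m)"
        unfolding e' by (simp add: power_add power_mult[symmetric] algebra_simps power2_eq_square)
      finally show "(\<Sum>i = m * 3..<m * 3 + 3. e' i * z ^ i) = (1 + \<i> * z + z\<^sup>2) * (e m * (z ^ 3) ^ m)" .
    qed
    also have "\<dots> = (1 + \<i> * z + z\<^sup>2) * (\<Sum>m<3 ^ n. e m * (z ^ 3) ^ m)"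
      by (simp add: sum_distrib_left)
    finally have "norm (\<Sum>m<3 ^ Suc n. e' m * z ^ m)
        = norm (1 + \<i> * z + z\<^sup>2) * norm (\<Sum>m<3 ^ n. e m * (z ^ 3) ^ m)"
      by (simp add: norm_mult)
    also have "\<dots> \<le> sqrt 5 * sqrt 5 ^ n"
      using norm_trinomial_le_on_circle[OF z] flat[of "z ^ 3"] z
      by (intro mult_mono) (auto simp: norm_power)
    finally show ?thesis by simp
  qed
  moreover have "norm (e' m) = 1" for m
    by (simp add: e'_def q_def e norm_mult)
  ultimately show ?case by blast
qed

text \<open>The maximum principle applied inside the disc to the polynomial, and outside the disc to its reversal
  \<open>z ^ (N - 1) * p (1 / z)\<close>.\<close>

lemma norm_polynomial_le_if_le_on_circle:
  fixes e :: "nat \<Rightarrow> complex"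
  assumes circle: "\<And>z. norm z = 1 \<Longrightarrow> norm (\<Sum>m<N. e m * z ^ m) \<le> B"
  shows "norm (\<Sum>m<N. e m * z ^ m) \<le> B * max 1 (norm z ^ N)"
proof -
  have disc: "norm (\<Sum>m<N. d m * w ^ m) \<le> B"
    if "\<And>z. norm z = 1 \<Longrightarrow> norm (\<Sum>m<N. d m * z ^ m) \<le> B" "norm w \<le> 1"
    for d :: "nat \<Rightarrow> complex" and w
  proof (rule maximum_modulus_frontier[of "\<lambda>z. \<Sum>m<N. d m * z ^ m" "cball 0 1"])
    show "(\<lambda>z. \<Sum>m<N. d m * z ^ m) holomorphic_on interior (cball 0 1)"
      by (intro holomorphic_intros)
    show "continuous_on (closure (cball 0 1)) (\<lambda>z. \<Sum>m<N. d m * z ^ m)"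
      by (intro continuous_intros)
  qed (use that in auto)
  have "0 \<le> B"
    using order_trans[OF norm_ge_zero circle[of 1]] by simp
  show ?thesis
  proof (cases "norm z \<le> 1")
    case True
    then show ?thesis
      using disc[of e z] circle by (simp add: max_absorb1 power_le_one)
  next
    case False
    have reversal: "(\<Sum>m<N. e m * w ^ m) = w ^ (N - 1) * (\<Sum>m<N. e (N - Suc m) * inverse w ^ m)"
      if "w \<noteq> 0" for w
    proof -
      have "w ^ (N - 1) * (\<Sum>m<N. e (N - Suc m) * inverse w ^ m)
          = (\<Sum>m<N. e (N - Suc m) * w ^ (N - Suc m))"
        unfolding sum_distrib_left using that
        by (intro sum.cong) (auto simp: power_diff field_simps power_Suc[symmetric] simp del: power_Suc)
      also have "\<dots> = (\<Sum>m<N. e m * w ^ m)"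
        by (rule sum.nat_diff_reindex)
      finally show ?thesis by simp
    qed
    have "norm (\<Sum>m<N. e (N - Suc m) * inverse z ^ m) \<le> B"
    proof (rule disc)
      fix w :: complex
      assume w: "norm w = 1"
      then show "norm (\<Sum>m<N. e (N - Suc m) * w ^ m) \<le> B"
        using reversal[of "inverse w"] circle[of "inverse w"]
        by (force simp: norm_mult norm_power norm_inverse)
    qed (use False in \<open>simp add: norm_inverse inverse_le_1_iff\<close>)
    moreover have "norm z ^ (N - 1) \<le> norm z ^ N"
      using False by (intro power_increasing) auto
    moreover have "norm (\<Sum>m<N. e m * z ^ m)
        = norm z ^ (N - 1) * norm (\<Sum>m<N. e (N - Suc m) * inverse z ^ m)"
      using False by (subst reversal) (auto simp: norm_mult norm_power)
    ultimately have "norm (\<Sum>m<N. e m * z ^ m) \<le> norm z ^ N * B"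
      by (simp add: mult_mono)
    also have "\<dots> \<le> B * max 1 (norm z ^ N)"
      using \<open>0 \<le> B\<close> by (simp add: mult.commute mult_left_mono)
    finally show ?thesis .
  qed
qed

section \<open>Weighted spaces in terms of power series\<close>

text \<open>Taylor coefficients determine an entire function, so membership in the weighted space can be read off
  from the power series. The functions themselves disappear from most of the arguments below.\<close>

lemma taylor_coeffs_H_infty:
  "taylor_coeffs ` H_infty v =
     {x. (\<forall>z. summable (\<lambda>n. x n * z ^ n)) \<and>
         (\<exists>C. \<forall>z. norm (\<Sum>n. x n * z ^ n) * v (norm z) \<le> C)}"
proof (intro equalityI subsetI)
  fix x
  assume "x \<in> taylor_coeffs ` H_infty v"
  then obtain f where f: "f holomorphic_on UNIV"
    and bdd: "bdd_above (range (\<lambda>z. norm (f z) * v (norm z)))" and x: "x = taylor_coeffs f"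
    by (auto simp: H_infty_def)
  have sums: "(\<lambda>n. x n * z ^ n) sums f z" for z
    using holomorphic_power_series[of f 0 "norm z + 1" z] f
    by (auto simp: x taylor_coeffs_def holomorphic_on_subset)
  from bdd obtain C where "\<And>z. norm (f z) * v (norm z) \<le> C"
    by (auto simp: bdd_above_def)
  with sums show "x \<in> {x. (\<forall>z. summable (\<lambda>n. x n * z ^ n)) \<and>
         (\<exists>C. \<forall>z. norm (\<Sum>n. x n * z ^ n) * v (norm z) \<le> C)}"
    by (auto simp: sums_iff)
next
  fix x :: "nat \<Rightarrow> complex"
  assume "x \<in> {x. (\<forall>z. summable (\<lambda>n. x n * z ^ n)) \<and>
         (\<exists>C. \<forall>z. norm (\<Sum>n. x n * z ^ n) * v (norm z) \<le> C)}"
  then obtain C where summable: "\<And>z. summable (\<lambda>n. x n * z ^ n)"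
    and bound: "\<And>z. norm (\<Sum>n. x n * z ^ n) * v (norm z) \<le> C"
    by auto
  define f where "f = eval_fps (Abs_fps x)"
  have f: "f z = (\<Sum>n. x n * z ^ n)" for z
    by (simp add: f_def eval_fps_def)
  have radius: "fps_conv_radius (Abs_fps x) = \<infinity>"
    unfolding fps_conv_radius_def using summable by (simp add: conv_radius_inftyI'')
  have "f \<in> H_infty v"
    using bound radius unfolding H_infty_def f_def[symmetric]
    by (auto simp: bdd_above_def f f_def intro!: holomorphic_on_eval_fps simp flip: f)
  moreover have "taylor_coeffs f = x"
    using fps_nth_fps_expansion[OF eval_fps_has_fps_expansion, of "Abs_fps x"] radius
    by (auto simp: taylor_coeffs_def f_def fun_eq_iff)
  ultimately show "x \<in> taylor_coeffs ` H_infty v"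
    by blast
qed

section \<open>Log-convex weight sequences and their maximal terms\<close>

text \<open>\<open>S p\<close> is the logarithm of the quotient \<open>\<mu>\<^sub>p\<close>, so \<open>log M\<close> is the primitive of \<open>S\<close>, and \<open>\<delta>\<close> is the sequence of
  increments of \<open>S\<close>.\<close>

locale log_quotients =
  fixes S M :: "nat \<Rightarrow> real"
  assumes S_0: "S 0 = 0"
    and mono_S: "mono S"
    and S_at_top: "filterlim S at_top sequentially"
    and M_eq_prod: "M p = (\<Prod>i=1..p. exp (S i))"
begin

lemma M_pos: "M p > 0"
  by (simp add: M_eq_prod prod_pos)

lemma M_0: "M 0 = 1"
  by (simp add: M_eq_prod)

lemma M_Suc: "M (Suc p) = M p * exp (S (Suc p))"
  by (simp add: M_eq_prod)

lemma quot_seq_eq: "quot_seq M p = exp (S p)"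
  using M_pos less_imp_neq by (cases p) (fastforce simp: quot_seq_def M_Suc S_0)+

text \<open>The next two lemmas express that \<open>log M\<close> is convex: to the right of \<open>m\<close> it lies above the line whose slope is
  at most the next slope of \<open>log M\<close>, and below the line whose slope is at least the last one.\<close>

lemma M_growth_ge:
  assumes "m \<le> n" "s \<le> S (Suc m)"
  shows "M m * exp s ^ (n - m) \<le> M n"
  using \<open>m \<le> n\<close>
proof (induction n rule: dec_induct)
  case (step n)
  have "s \<le> S (Suc n)"
    using assms(2) monoD[OF mono_S, of "Suc m" "Suc n"] step.hyps by simp
  with step.IH M_pos show ?case
    using mult_mono[of "M m * exp s ^ (n - m)" "M n" "exp s" "exp (S (Suc n))"]
    by (simp add: Suc_diff_le step.hyps M_Suc mult_ac less_imp_le)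
qed simp

lemma M_growth_le:
  assumes "m \<le> n" "S n \<le> s"
  shows "M n \<le> M m * exp s ^ (n - m)"
  using assms
proof (induction n rule: dec_induct)
  case (step n)
  have "S n \<le> s"
    using step.prems monoD[OF mono_S, of n "Suc n"] by simp
  with step M_pos[of m] show ?case
    using mult_mono[of "M n" "M m * exp s ^ (n - m)" "exp (S (Suc n))" "exp s"]
    by (simp add: Suc_diff_le step.hyps M_Suc mult_ac less_imp_le)
qed simp

text \<open>The logarithm of \<open>exp s ^ m / M m\<close> has increments \<open>s - S m\<close>, which change sign after \<open>n\<close>.\<close>

lemma power_over_M_le_maximal_term:
  assumes "S n \<le> s" "s \<le> S (Suc n)"
  shows "exp s ^ m / M m \<le> exp s ^ n / M n"
proof (cases "n \<le> m")
  case True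
  have "exp s ^ m * M n = exp s ^ n * (M n * exp s ^ (m - n))"
    using True by (simp add: power_add[symmetric] mult_ac)
  also have "\<dots> \<le> exp s ^ n * M m"
    using M_growth_ge[OF True assms(2)] by (intro mult_left_mono) auto
  finally show ?thesis
    using M_pos by (simp add: field_simps)
next
  case False
  then have "m \<le> n" by simp
  have "exp s ^ m * M n \<le> exp s ^ m * (M m * exp s ^ (n - m))"
    using M_growth_le[OF \<open>m \<le> n\<close> assms(1)] by (intro mult_left_mono) auto
  also have "\<dots> = exp s ^ n * M m"
    using \<open>m \<le> n\<close> by (simp add: power_add[symmetric] mult_ac)
  finally show ?thesis
    using M_pos by (simp add: field_simps)
qed

lemma summable_power_over_M:
  assumes "t \<ge> 0"
  shows "summable (\<lambda>n. t ^ n / M n)"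
proof -
  obtain N where N: "\<And>n. n \<ge> N \<Longrightarrow> 2 * t \<le> S n"
    using S_at_top unfolding filterlim_at_top eventually_sequentially by meson
  show ?thesis
  proof (rule summable_ratio_test[of "1/2" N])
    fix n assume "n \<ge> N"
    then have "2 * t \<le> exp (S (Suc n))"
      using N[of "Suc n"] exp_ge_add_one_self[of "S (Suc n)"] by linarith
    then have "t / exp (S (Suc n)) * (t ^ n / M n) \<le> 1 / 2 * (t ^ n / M n)"
      using assms M_pos[of n] by (intro mult_right_mono) (auto simp: field_simps)
    then show "norm (t ^ Suc n / M (Suc n)) \<le> 1 / 2 * norm (t ^ n / M n)"
      using assms M_pos[of n] by (simp add: M_Suc mult_ac abs_mult)
  qed simp
qed

text \<open>Only the growth condition needs an argument: the terms \<open>R ^ p / M p\<close> of a convergent series are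
  eventually below 1, so the roots of \<open>M p\<close> eventually exceed \<open>R\<close>.\<close>

lemma M_in_LC: "M \<in> LC"
proof -
  have "filterlim (\<lambda>p. M p powr (1 / real p)) at_top sequentially"
    unfolding filterlim_at_top_gt[where c = 0]
  proof (intro allI impI)
    fix R :: real assume R: "R > 0"
    have "(\<lambda>p. R ^ p / M p) \<longlonglongrightarrow> 0"
      using R by (intro summable_LIMSEQ_zero summable_power_over_M) simp
    then have "eventually (\<lambda>p. R ^ p / M p < 1) sequentially"
      by (rule order_tendstoD) simp
    then show "eventually (\<lambda>p. R \<le> M p powr (1 / real p)) sequentially"
      using eventually_gt_at_top[of 0]
    proof eventually_elim
      case (elim p)
      then have "(R ^ p) powr (1 / real p) \<le> M p powr (1 / real p)"
        using R M_pos[of p] by (intro powr_mono2) (auto simp: field_simps)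
      moreover have "(R ^ p) powr (1 / real p) = R"
        using R elim by (simp add: powr_realpow[symmetric] powr_powr)
      ultimately show ?case by simp
    qed
  qed
  moreover have "1 \<le> M 1"
    using monoD[OF mono_S, of 0 1] by (simp add: M_eq_prod S_0)
  moreover have "(M p)\<^sup>2 \<le> M (p - 1) * M (p + 1)" if "p \<ge> 1" for p
  proof -
    obtain n where p: "p = Suc n" using \<open>p \<ge> 1\<close> by (cases p) auto
    have "exp (S p) \<le> exp (S (Suc p))"
      using monoD[OF mono_S, of p "Suc p"] by simp
    then have "M n * M p * exp (S p) \<le> M n * M p * exp (S (Suc p))"
      using M_pos[of n] M_pos[of p] by (intro mult_left_mono) auto
    then show ?thesis
      by (simp add: p M_Suc power2_eq_square mult_ac)
  qed
  ultimately show ?thesis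
    by (simp add: LC_def M_pos M_0)
qed

lemma power_over_M_le_exp_omega:
  assumes "t \<ge> 0"
  shows "t ^ p / M p \<le> exp (omega M t)"
proof (cases "t = 0")
  case True
  then show ?thesis
    by (cases p) (auto simp: omega_def M_0)
next
  case False
  with assms have t: "t > 0" by simp
  have le: "t ^ p / M p \<le> (\<Sum>n. t ^ n / M n)" for p
    using sum_le_suminf[OF summable_power_over_M[OF assms], of "{p}"] t M_pos
    by (simp add: less_imp_le)
  have "bdd_above (range (\<lambda>p. ln (t ^ p / M p)))"
  proof (intro bdd_aboveI2)
    show "ln (t ^ p / M p) \<le> ln (\<Sum>n. t ^ n / M n)" for p
      using t M_pos[of p] by (intro ln_mono le) auto
  qed
  then have "ln (t ^ p / M p) \<le> omega M t"
    using t by (auto simp: omega_def intro: cSUP_upper)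
  then have "exp (ln (t ^ p / M p)) \<le> exp (omega M t)"
    by simp
  then show ?thesis
    using t M_pos[of p] by simp
qed

lemma exp_omega_eq_maximal_term:
  assumes "S n \<le> s" "s \<le> S (Suc n)"
  shows "exp (omega M (exp s)) = exp s ^ n / M n"
proof (rule antisym)
  have "omega M (exp s) \<le> ln (exp s ^ n / M n)"
    unfolding omega_def using power_over_M_le_maximal_term[OF assms] M_pos
    by (auto intro!: cSUP_least ln_mono)
  then show "exp (omega M (exp s)) \<le> exp s ^ n / M n"
    using M_pos[of n] by (subst (asm) ln_ge_iff) auto
qed (rule power_over_M_le_exp_omega, simp)

lemma exp_omega_ge_1: "t \<ge> 0 \<Longrightarrow> exp (omega M t) \<ge> 1"
  using power_over_M_le_exp_omega[of t 0] by (simp add: M_0)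

lemma taylor_coeffs_H_infty_weight_iff:
  "x \<in> taylor_coeffs ` H_infty (weight M c) \<longleftrightarrow>
     (\<forall>z. summable (\<lambda>n. x n * z ^ n)) \<and>
     (\<exists>C. \<forall>z. norm (\<Sum>n. x n * z ^ n) \<le> C * exp (omega M (c * norm z)))"
proof -
  have "a * weight M c r \<le> C \<longleftrightarrow> a \<le> C * exp (omega M (c * r))" for a r C
    unfolding weight_def exp_minus divide_inverse[symmetric] by (rule pos_divide_le_eq) simp
  then show ?thesis
    by (simp add: taylor_coeffs_H_infty)
qed

text \<open>Cauchy's estimate is optimal on the circle of radius \<open>exp (S (Suc n)) / c\<close>: there the supremum that defines
  \<open>omega\<close> is attained at the index \<open>n\<close>.\<close>

lemma coeffs_of_H_infty_bounded:
  assumes "c > 0" "x \<in> taylor_coeffs ` H_infty (weight M c)"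
  obtains C where "\<And>n. norm (x n) * M n \<le> C * c ^ n"
proof -
  obtain f where f: "f holomorphic_on UNIV" and x: "x = taylor_coeffs f"
    and bdd: "bdd_above (range (\<lambda>z. norm (f z) * weight M c (norm z)))"
    using assms(2) unfolding H_infty_def by blast
  from bdd obtain C where "\<And>z. norm (f z) / exp (omega M (c * norm z)) \<le> C"
    by (auto simp: bdd_above_def weight_def exp_minus divide_inverse)
  then have C: "\<And>z. norm (f z) \<le> C * exp (omega M (c * norm z))"
    by (simp add: pos_divide_le_eq)
  have "norm (x n) * M n \<le> C * c ^ n" for n
  proof -
    define t where "t = exp (S (Suc n))"
    have "t > 0" by (simp add: t_def)
    have "norm ((deriv ^^ n) f 0) \<le> fact n * (C * (t ^ n / M n)) / (t / c) ^ n"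
    proof (rule Cauchy_inequality)
      fix z :: complex assume "norm (0 - z) = t / c"
      then have "c * norm z = t" using \<open>c > 0\<close> by simp
      moreover have "exp (omega M t) = t ^ n / M n"
        unfolding t_def using monoD[OF mono_S, of n "Suc n"]
        by (intro exp_omega_eq_maximal_term) auto
      ultimately show "norm (f z) \<le> C * (t ^ n / M n)"
        using C[of z] by simp
    qed (use f \<open>t > 0\<close> \<open>c > 0\<close> in
         \<open>auto intro: holomorphic_on_subset holomorphic_on_imp_continuous_on\<close>)
    also have "\<dots> = fact n * (C * c ^ n / M n)"
      using \<open>t > 0\<close> \<open>c > 0\<close> by (simp add: field_simps)
    finally show ?thesis
      using M_pos[of n] by (simp add: x taylor_coeffs_def norm_divide field_simps)
  qed
  then show ?thesis by (rule that)
qed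

section \<open>A sufficient condition for solidity\<close>

lemma
  fixes x :: "nat \<Rightarrow> complex"
  assumes "c > 0" and x: "\<And>n. norm (x n) * M n \<le> C * c ^ n"
  shows summable_if_coeffs_bounded: "summable (\<lambda>n. x n * z ^ n)" (is ?thesis1)
    and norm_suminf_le_if_coeffs_bounded:
      "norm (\<Sum>n. x n * z ^ n) \<le> C * (\<Sum>n. (c * norm z) ^ n / M n)" (is ?thesis2)
proof -
  have le: "norm (x n * z ^ n) \<le> C * ((c * norm z) ^ n / M n)" for n
  proof -
    have "norm (x n) \<le> C * c ^ n / M n"
      using x[of n] M_pos[of n] by (simp add: pos_le_divide_eq)
    then have "norm (x n) * norm z ^ n \<le> C * c ^ n / M n * norm z ^ n"
      by (intro mult_right_mono) auto
    then show ?thesis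
      by (simp add: norm_mult norm_power power_mult_distrib)
  qed
  have sum: "summable (\<lambda>n. C * ((c * norm z) ^ n / M n))"
    using \<open>c > 0\<close> by (intro summable_mult summable_power_over_M) simp
  show ?thesis1
    using le by (intro summable_comparison_test'[OF sum])
  have "norm (\<Sum>n. x n * z ^ n) \<le> (\<Sum>n. C * ((c * norm z) ^ n / M n))"
    using norm_suminf_le[OF le sum] .
  also have "\<dots> = C * (\<Sum>n. (c * norm z) ^ n / M n)"
    using \<open>c > 0\<close> by (intro suminf_mult summable_power_over_M) simp
  finally show ?thesis2 .
qed

text \<open>Cauchy's estimate sees only the moduli of the coefficients. If the sum of all terms \<open>t ^ n / M n\<close> is
  comparable to the largest one, that estimate alone already puts a sequence into the space, which is
  then described by a condition on moduli.\<close>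

lemma solid_if_sum_le_exp_omega:
  assumes "c > 0"
    and D: "\<And>t. t \<ge> 0 \<Longrightarrow> (\<Sum>n. t ^ n / M n) \<le> D * exp (omega M t)"
  shows "solid (taylor_coeffs ` H_infty (weight M c))"
  unfolding solid_def
proof (intro allI impI)
  fix x y :: "nat \<Rightarrow> complex"
  assume x: "x \<in> taylor_coeffs ` H_infty (weight M c)" and yx: "\<forall>j. norm (y j) \<le> norm (x j)"
  obtain C where C: "\<And>n. norm (x n) * M n \<le> C * c ^ n"
    using coeffs_of_H_infty_bounded[OF \<open>c > 0\<close> x] by blast
  have "C \<ge> 0"
    using order_trans[OF norm_ge_zero, of "x 0" C] C[of 0] by (simp add: M_0)
  have y: "norm (y n) * M n \<le> C * c ^ n" for n
  proof -
    have "norm (y n) * M n \<le> norm (x n) * M n"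
      using yx M_pos[of n] by (simp add: mult_right_mono)
    then show ?thesis using C[of n] by linarith
  qed
  have "norm (\<Sum>n. y n * z ^ n) \<le> C * D * exp (omega M (c * norm z))" for z
  proof -
    have "norm (\<Sum>n. y n * z ^ n) \<le> C * (\<Sum>n. (c * norm z) ^ n / M n)"
      by (rule norm_suminf_le_if_coeffs_bounded[OF \<open>c > 0\<close> y])
    also have "\<dots> \<le> C * (D * exp (omega M (c * norm z)))"
      using \<open>C \<ge> 0\<close> \<open>c > 0\<close> by (intro mult_left_mono D) auto
    finally show ?thesis by (simp add: mult.assoc)
  qed
  then show "y \<in> taylor_coeffs ` H_infty (weight M c)"
    unfolding taylor_coeffs_H_infty_weight_iff
    using summable_if_coeffs_bounded[OF \<open>c > 0\<close> y] by blast
qed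

text \<open>If \<open>S\<close> gains a fixed amount over every \<open>q\<close> steps, then more than \<open>q\<close> steps away from the maximal term
  consecutive terms \<open>t ^ n / M n\<close> decay geometrically, with ratio \<open>exp (- \<eta>)\<close>, in both directions. The
  constant does not depend on \<open>t\<close>.\<close>

lemma sum_le_exp_omega_if_separated:
  assumes "\<eta> > 0" and separated: "\<And>n. S n + \<eta> \<le> S (n + q)"
  shows "\<exists>D. \<forall>t\<ge>0. (\<Sum>n. t ^ n / M n) \<le> D * exp (omega M t)"
proof -
  define \<rho> where "\<rho> = exp (- \<eta>)"
  have \<rho>: "0 < \<rho>" "\<rho> < 1" using \<open>\<eta> > 0\<close> by (auto simp: \<rho>_def)
  define E where "E = (\<Sum>k. \<rho> ^ (k - q))"
  have summable_E: "summable (\<lambda>k. \<rho> ^ (k - q))"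
    using \<rho> by (subst summable_iff_shift[of _ q, symmetric]) simp
  have large: "(\<Sum>m. t ^ m / M m) \<le> 2 * E * exp (omega M t)" if "t \<ge> 1" for t
  proof -
    define s where "s = ln t"
    have t: "t = exp s" and "s \<ge> 0" using that by (auto simp: s_def)
    \<comment> \<open>The index of the maximal term: the last \<open>n\<close> with \<open>S n \<le> ln t\<close>.\<close>
    define n where "n = (LEAST n. s < S (Suc n))"
    have "\<exists>n. s < S (Suc n)"
      using S_at_top unfolding filterlim_at_top_dense eventually_sequentially
      by (meson le_SucI order_refl)
    then have "s < S (Suc n)"
      unfolding n_def by (rule LeastI_ex)
    have "S n \<le> s"
    proof (cases n)
      case (Suc n')
      then show ?thesis
        using not_less_Least[of n' "\<lambda>n. s < S (Suc n)"] by (simp add: n_def[symmetric])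
    qed (simp add: S_0 \<open>s \<ge> 0\<close>)
    define u where "u m = t ^ m / M m" for m
    have u_nonneg: "u m \<ge> 0" for m
      using M_pos[of m] by (simp add: u_def t)
    have u_le: "u m \<le> u n" for m
      unfolding u_def t using \<open>S n \<le> s\<close> \<open>s < S (Suc n)\<close>
      by (intro power_over_M_le_maximal_term) auto
    have u_Suc: "u (Suc m) = u m * exp (s - S (Suc m))" for m
      by (simp add: u_def M_Suc t exp_diff)
    have up: "u (n + q + k) \<le> u n * \<rho> ^ k" for k
    proof (induction k)
      case (Suc k)
      have "s + \<eta> \<le> S (Suc (n + q + k))"
        using separated[of "Suc n"] \<open>s < S (Suc n)\<close>
          monoD[OF mono_S, of "Suc n + q" "Suc (n + q + k)"] by simp
      then have "u (n + q + k) * exp (s - S (Suc (n + q + k))) \<le> u n * \<rho> ^ k * \<rho>"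
        using Suc.IH \<rho> u_nonneg by (intro mult_mono) (auto simp: \<rho>_def)
      then show ?case by (simp add: u_Suc mult_ac)
    qed (simp add: u_le)
    have down: "u m \<le> u n * \<rho> ^ k" if "m + q + k = n" for m k
      using that
    proof (induction k arbitrary: m)
      case (Suc k)
      have "S (Suc m) \<le> s - \<eta>"
        using separated[of "Suc m"] \<open>S n \<le> s\<close> monoD[OF mono_S, of "Suc m + q" n] Suc.prems by simp
      then have "u (Suc m) * exp (S (Suc m) - s) \<le> u n * \<rho> ^ k * \<rho>"
        using Suc.IH[of "Suc m"] Suc.prems \<rho> u_nonneg by (intro mult_mono) (auto simp: \<rho>_def)
      moreover have "u (Suc m) * exp (S (Suc m) - s) = u m"
        by (simp add: u_Suc exp_diff)
      ultimately show ?case by (simp add: mult_ac)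
    qed (simp add: u_le)
    have "(\<Sum>k. u (k + n)) \<le> (\<Sum>k. u n * \<rho> ^ (k - q))"
    proof (rule suminf_le)
      show "u (k + n) \<le> u n * \<rho> ^ (k - q)" for k
        using up[of "k - q"] u_le[of "k + n"] by (cases "q \<le> k") (auto simp: add.commute)
      show "summable (\<lambda>k. u (k + n))"
        using summable_power_over_M[of t] \<open>t \<ge> 1\<close>
        by (subst summable_iff_shift) (simp add: u_def[abs_def])
    qed (intro summable_mult summable_E)
    also have "\<dots> = u n * E"
      unfolding E_def by (rule suminf_mult[OF summable_E])
    finally have right: "(\<Sum>k. u (k + n)) \<le> u n * E" .
    have "(\<Sum>m<n. u m) = (\<Sum>k<n. u (n - Suc k))"
      by (rule sum.nat_diff_reindex[symmetric])
    also have "\<dots> \<le> (\<Sum>k<n. u n * \<rho> ^ (k - q))"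
    proof (rule sum_mono)
      fix k assume "k \<in> {..<n}"
      show "u (n - Suc k) \<le> u n * \<rho> ^ (k - q)"
      proof (cases "q \<le> k")
        case True
        then have "u (n - Suc k) \<le> u n * \<rho> ^ Suc (k - q)"
          using \<open>k \<in> {..<n}\<close> by (intro down) auto
        also have "\<dots> \<le> u n * \<rho> ^ (k - q)"
          using \<rho> u_nonneg by (intro mult_left_mono power_decreasing) auto
        finally show ?thesis .
      qed (simp add: u_le)
    qed
    also have "\<dots> \<le> u n * E"
      unfolding E_def sum_distrib_left[symmetric]
      using \<rho> u_nonneg by (intro mult_left_mono sum_le_suminf summable_E) auto
    finally have left: "(\<Sum>m<n. u m) \<le> u n * E" .
    have "summable u"
      unfolding u_def using \<open>t \<ge> 1\<close> by (intro summable_power_over_M) simp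
    then have "(\<Sum>m. u m) = (\<Sum>k. u (k + n)) + (\<Sum>m<n. u m)"
      by (rule suminf_split_initial_segment)
    also have "\<dots> \<le> 2 * E * u n"
      using add_mono[OF right left] by (simp add: algebra_simps)
    also have "u n = exp (omega M t)"
      unfolding u_def t using \<open>S n \<le> s\<close> \<open>s < S (Suc n)\<close>
      by (intro exp_omega_eq_maximal_term[symmetric]) auto
    finally show ?thesis by (simp add: u_def)
  qed
  \<comment> \<open>For \<open>t < 1\<close> the series is at most its value at 1, and \<open>exp (omega M t) \<ge> 1\<close>.\<close>
  define D where "D = max (2 * E) (\<Sum>n. 1 / M n)"
  have "(\<Sum>n. t ^ n / M n) \<le> D * exp (omega M t)" if "t \<ge> 0" for t
  proof (cases "t \<ge> 1")
    case True
    then show ?thesis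
      using large[OF True] by (rule_tac order_trans) (auto simp: D_def intro!: mult_right_mono)
  next
    case False
    have summable_1: "summable (\<lambda>n. 1 / M n)"
      using summable_power_over_M[of 1] by simp
    have "(\<Sum>n. t ^ n / M n) \<le> (\<Sum>n. 1 / M n)"
      using that False M_pos
      by (intro suminf_le summable_1 summable_power_over_M)
         (auto intro!: divide_right_mono power_le_one simp: less_imp_le)
    also have "\<dots> \<le> D * 1"
      by (simp add: D_def)
    also have "\<dots> \<le> D * exp (omega M t)"
    proof (rule mult_left_mono[OF exp_omega_ge_1[OF that]])
      have "0 \<le> (\<Sum>n. 1 / M n)"
        using M_pos by (intro suminf_nonneg summable_1) (simp add: less_imp_le)
      then show "0 \<le> D" by (simp add: D_def)
    qed
    finally show ?thesis .
  qed
  then show ?thesis by blast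
qed

section \<open>Long blocks of comparable terms prevent solidity\<close>

text \<open>Inside the circle of radius \<open>t\<close> the rescaled polynomial is controlled by its lowest power, so by the
  term with index \<open>k\<close>; outside it is controlled by its degree, which is
  at most \<open>l\<close>, so by the term with index \<open>l\<close>. The constant \<open>K\<close>, an upper bound for \<open>lusky_B M k l\<close>, compares the two terms on the circle itself.\<close>

lemma norm_block_le_exp_omega:
  fixes e :: "nat \<Rightarrow> complex"
  assumes e: "\<And>z. norm z = 1 \<Longrightarrow> norm (\<Sum>m<N. e m * z ^ m) \<le> F"
    and "k + N \<le> l" and B: "M l \<le> K * (M k * exp (S (Suc k)) ^ (l - k))"
  defines "t \<equiv> exp (S (Suc k))"
  shows "norm (\<Sum>m<N. e m * of_real (t ^ k / M k) * (y / of_real t) ^ (k + m))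
    \<le> F * K * exp (omega M (norm y))"
proof -
  have "t > 0" by (simp add: t_def)
  define r where "r = norm y / t"
  have "r \<ge> 0" using \<open>t > 0\<close> by (simp add: r_def)
  have "F \<ge> 0"
    using order_trans[OF norm_ge_zero e[of 1]] by simp
  have "M k * t ^ (l - k) \<le> K * (M k * t ^ (l - k))"
    using M_growth_ge[of k l "S (Suc k)"] B assms(2) unfolding t_def by simp
  then have "K \<ge> 1"
    using \<open>t > 0\<close> M_pos[of k] by (simp add: mult_le_cancel_right1)
  have "norm (\<Sum>m<N. e m * of_real (t ^ k / M k) * (y / of_real t) ^ (k + m))
      = norm (of_real (t ^ k / M k) * (y / of_real t) ^ k * (\<Sum>m<N. e m * (y / of_real t) ^ m))"
    unfolding sum_distrib_left by (intro arg_cong[where f = norm] sum.cong) (auto simp: power_add)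
  also have "\<dots> = norm y ^ k / M k * norm (\<Sum>m<N. e m * (y / of_real t) ^ m)"
    using \<open>t > 0\<close> M_pos[of k] by (simp add: norm_mult norm_divide norm_power power_divide)
  also have "\<dots> \<le> norm y ^ k / M k * (F * max 1 (norm (y / of_real t) ^ N))"
    using M_pos[of k] by (intro mult_left_mono norm_polynomial_le_if_le_on_circle e) auto
  also have "norm (y / of_real t) = r"
    using \<open>t > 0\<close> by (simp add: r_def norm_divide)
  also have "norm y ^ k / M k * (F * max 1 (r ^ N)) = F * (norm y ^ k / M k * max 1 (r ^ N))"
    by simp
  also have "\<dots> \<le> F * (K * exp (omega M (norm y)))"
  proof (rule mult_left_mono[OF _ \<open>F \<ge> 0\<close>], cases "r \<le> 1")
    case True
    then have "norm y ^ k / M k * max 1 (r ^ N) = norm y ^ k / M k"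
      using \<open>r \<ge> 0\<close> by (simp add: max_absorb1 power_le_one)
    also have "\<dots> \<le> exp (omega M (norm y))"
      by (rule power_over_M_le_exp_omega) simp
    also have "\<dots> \<le> K * exp (omega M (norm y))"
      using \<open>K \<ge> 1\<close> by simp
    finally show "norm y ^ k / M k * max 1 (r ^ N) \<le> K * exp (omega M (norm y))" .
  next
    case False
    have "norm y ^ k / M k * max 1 (r ^ N) \<le> norm y ^ k / M k * r ^ (l - k)"
      using False assms(2) M_pos[of k] 
      by (intro mult_left_mono) (auto intro: power_increasing one_le_power)
    also have "\<dots> = norm y ^ l / (M k * t ^ (l - k))"
      using assms(2) by (simp add: r_def power_divide power_add[symmetric])
    also have "\<dots> \<le> K * (norm y ^ l / M l)"
    proof -
      have "norm y ^ l * M l \<le> norm y ^ l * (K * (M k * t ^ (l - k)))"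
        using B by (intro mult_left_mono) (auto simp: t_def)
      then show ?thesis
        using M_pos[of k] M_pos[of l] \<open>t > 0\<close> by (simp add: field_simps)
    qed
    also have "\<dots> \<le> K * exp (omega M (norm y))"
      using \<open>K \<ge> 1\<close> by (intro mult_left_mono power_over_M_le_exp_omega) auto
    finally show "norm y ^ k / M k * max 1 (r ^ N) \<le> K * exp (omega M (norm y))" .
  qed
  finally show ?thesis by (simp add: mult.assoc)
qed


text \<open>A flat polynomial with \<open>81 ^ s\<close> unimodular coefficients and maximum at most \<open>25 ^ s\<close> on the circle, the
  case \<open>n = 4 * s\<close> of the product construction, is rescaled into the \<open>s\<close>-th block and divided by \<open>50 ^ s\<close>.
  The blocks then contribute at most \<open>K / 2 ^ s\<close> times the growth bound, so their sum is in the
  space. If all coefficients are replaced by their moduli, the \<open>s\<close>-th block alone contributes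
  \<open>(81 / 50) ^ s\<close> times the growth bound at the radius where the term with index \<open>k s\<close> is maximal,
  so the result is not in the space.\<close>

lemma not_solid_if_long_blocks:
  fixes k l :: "nat \<Rightarrow> nat"
  assumes "c > 0"
    and long: "\<And>s. k s + 81 ^ s \<le> l s"
    and ordered: "\<And>s. l s \<le> k (Suc s)"
    and B: "\<And>s. M (l s) \<le> K * (M (k s) * exp (S (Suc (k s))) ^ (l s - k s))"
  shows "\<not> solid (taylor_coeffs ` H_infty (weight M c))"
proof
  assume solid: "solid (taylor_coeffs ` H_infty (weight M c))"
  have "\<exists>e :: nat \<Rightarrow> complex. (\<forall>m. norm (e m) = 1) \<and>
      (\<forall>z. norm z = 1 \<longrightarrow> norm (\<Sum>m<81 ^ s. e m * z ^ m) \<le> 25 ^ s)" for s :: nat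
  proof -
    have "(3::nat) ^ (4 * s) = 81 ^ s" "sqrt 5 ^ (4 * s) = 25 ^ s"
      using power_mult[of "sqrt 5" 2 2] by (simp_all add: power_mult)
    then show ?thesis
      using exists_flat_unimodular_polynomial[of "4 * s"] by simp
  qed
  then obtain e :: "nat \<Rightarrow> nat \<Rightarrow> complex" where e: "\<And>s m. norm (e s m) = 1"
    and flat: "\<And>s z. norm z = 1 \<Longrightarrow> norm (\<Sum>m<81 ^ s. e s m * z ^ m) \<le> 25 ^ s"
    by metis
  have "k s < k (Suc s)" for s
    using long[of s] ordered[of s] zero_less_power[of "81 :: nat" s] by linarith
  then have mono_k: "strict_mono k"
    by (rule strict_monoI_Suc)
  define t where "t s = exp (S (Suc (k s)))" for s
  have t_pos: "t s > 0" for s by (simp add: t_def)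
  define p :: "nat \<Rightarrow> nat \<Rightarrow> complex" where
    "p s n = (if n \<in> {k s..<k s + 81 ^ s}
       then e s (n - k s) * of_real (t s ^ k s / M (k s)) / of_real (t s) ^ n / 50 ^ s else 0)"
    for s n
  \<comment> \<open>Row \<open>s\<close> of \<open>p\<close> vanishes at \<open>n < s\<close> because \<open>s \<le> k s\<close>, so \<open>x n / c ^ n\<close> is the sum of the whole column \<open>n\<close>.\<close>
  define x where "x n = c ^ n * (\<Sum>s\<le>n. p s n)" for n
  have norm_p: "norm (p s n) = (1 / 50) ^ s * (t s ^ k s / M (k s) / t s ^ n)"
    if "n \<in> {k s..<k s + 81 ^ s}" for s n
    using that t_pos[of s] M_pos[of "k s"]
    by (simp add: p_def norm_mult norm_divide norm_power e power_one_over)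
  have "K \<ge> 1"
  proof -
    have "M (k 0) * t 0 ^ (l 0 - k 0) \<le> K * (M (k 0) * t 0 ^ (l 0 - k 0))"
      using M_growth_ge[of "k 0" "l 0" "S (Suc (k 0))"] B[of 0] long[of 0] unfolding t_def by simp
    then show ?thesis
      using t_pos M_pos by (simp add: mult_le_cancel_right1)
  qed
  have p_le: "norm (p s n) \<le> (1 / 2) ^ s * (K / M n)" for s n
  proof (cases "n \<in> {k s..<k s + 81 ^ s}")
    case True
    then have n: "k s \<le> n" "n \<le> l s" using long[of s] by auto
    have "S (Suc (k s)) \<le> S (Suc n)"
      using n by (intro monoD[OF mono_S]) simp
    then have "M n * t s ^ (l s - n) \<le> M (l s)"
      unfolding t_def by (rule M_growth_ge[OF n(2)])
    also have "\<dots> \<le> K * (M (k s) * t s ^ (l s - k s))"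
      using B[of s] by (simp add: t_def)
    also have "t s ^ (l s - k s) = t s ^ (n - k s) * t s ^ (l s - n)"
      using n by (simp flip: power_add)
    finally have "M n \<le> K * (M (k s) * t s ^ (n - k s))"
      using t_pos[of s] by (simp flip: mult.assoc)
    then have "t s ^ k s * M n \<le> K * (M (k s) * (t s ^ k s * t s ^ (n - k s)))"
      using t_pos[of s] by (simp add: mult_ac)
    also have "t s ^ k s * t s ^ (n - k s) = t s ^ n"
      using n by (simp flip: power_add)
    finally have "t s ^ k s / M (k s) / t s ^ n \<le> K / M n"
      using t_pos[of s] M_pos by (simp add: field_simps)
    moreover have "(1 / 50) ^ s \<le> ((1 / 2) ^ s :: real)"
      by (intro power_mono) auto
    ultimately show ?thesis
      unfolding norm_p[OF True]
      using t_pos[of s] M_pos[of "k s"] by (intro mult_mono) (auto simp: less_imp_le)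
  next
    case False
    then have "p s n = 0" by (auto simp: p_def)
    then show ?thesis using \<open>K \<ge> 1\<close> M_pos[of n] by simp
  qed
  have half: "(\<Sum>s\<in>A. (1 / 2) ^ s) \<le> (2 :: real)" if "finite A" for A :: "nat set"
    using sum_le_suminf[of "\<lambda>s. (1 / 2 :: real) ^ s" A] that by (simp add: suminf_geometric)
  \<comment> \<open>This crude bound only serves convergence: the sum of its majorants can be far larger than the growth bound.\<close>
  have x_le: "norm (x n) * M n \<le> 2 * K * c ^ n" for n
  proof -
    have "norm (\<Sum>s\<le>n. p s n) \<le> (\<Sum>s\<le>n. (1 / 2) ^ s * (K / M n))"
      by (rule sum_norm_le) (rule p_le)
    also have "\<dots> \<le> 2 * (K / M n)"
      unfolding sum_distrib_right[symmetric]
      using half[of "{..n}"] \<open>K \<ge> 1\<close> M_pos[of n] by (intro mult_right_mono) auto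
    finally have "norm (\<Sum>s\<le>n. p s n) * M n \<le> 2 * K"
      using M_pos[of n] by (simp add: field_simps)
    then have "c ^ n * (norm (\<Sum>s\<le>n. p s n) * M n) \<le> c ^ n * (2 * K)"
      using \<open>c > 0\<close> by (intro mult_left_mono) auto
    then show ?thesis
      using \<open>c > 0\<close> by (simp add: x_def norm_mult norm_power mult_ac)
  qed
  have summable_x: "summable (\<lambda>n. x n * z ^ n)" for z
    by (rule summable_if_coeffs_bounded[OF \<open>c > 0\<close> x_le])
  have "norm (\<Sum>n. x n * z ^ n) \<le> 2 * K * exp (omega M (c * norm z))" for z
  proof -
    define y where "y = of_real c * z"
    have block: "norm (\<Sum>n<k J. p s n * y ^ n) \<le> (1 / 2) ^ s * (K * exp (omega M (norm y)))"
      if "s < J" for s J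
    proof -
      have "k (Suc s) \<le> k J"
        using that strict_mono_mono[OF mono_k] by (intro monoD[of k]) auto
      then have sub: "{k s..<k s + 81 ^ s} \<subseteq> {..<k J}"
        using long[of s] ordered[of s] by auto
      have "(\<Sum>n<k J. p s n * y ^ n) = (\<Sum>n = k s..<k s + 81 ^ s. p s n * y ^ n)"
        by (intro sum.mono_neutral_right) (use sub in \<open>auto simp: p_def\<close>)
      also have "\<dots> = (\<Sum>m<81 ^ s. p s (k s + m) * y ^ (k s + m))"
        using sum.shift_bounds_nat_ivl[of "\<lambda>n. p s n * y ^ n" 0 "k s" "81 ^ s"]
        by (simp add: atLeast0LessThan add.commute)
      also have "\<dots> = (\<Sum>m<81 ^ s. e s m * of_real (t s ^ k s / M (k s)) *
          (y / of_real (t s)) ^ (k s + m) / 50 ^ s)"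
        by (intro sum.cong) (auto simp: p_def power_divide)
      also have "norm \<dots> = (1 / 50) ^ s * norm (\<Sum>m<81 ^ s. e s m * of_real (t s ^ k s / M (k s)) *
          (y / of_real (t s)) ^ (k s + m))"
        by (simp add: norm_mult norm_divide norm_power power_one_over flip: sum_divide_distrib)
      also have "\<dots> \<le> (1 / 50) ^ s * (25 ^ s * K * exp (omega M (norm y)))"
        unfolding t_def using long
        by (intro mult_left_mono norm_block_le_exp_omega[OF flat _ B]) auto
      also have "\<dots> = (1 / 2) ^ s * (K * exp (omega M (norm y)))"
        by (simp add: power_one_over power_mult_distrib[symmetric] field_simps)
      finally show ?thesis .
    qed
    \<comment> \<open>Partial sums that end between two blocks are sums of complete blocks.\<close>
    have partial: "norm (\<Sum>n<k J. x n * z ^ n) \<le> 2 * K * exp (omega M (norm y))" for J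
    proof -
      have "(\<Sum>s\<le>n. p s n) = (\<Sum>s<J. p s n)" if "n < k J" for n
      proof (rule sum.mono_neutral_cong)
        fix s assume "s \<in> {..<J} - {..n}"
        then show "p s n = 0"
          using strict_mono_imp_increasing[OF mono_k, of s] by (auto simp: p_def)
      next
        fix s assume "s \<in> {..n} - {..<J}"
        then have "k J \<le> k s"
          using strict_mono_mono[OF mono_k] by (intro monoD[of k]) auto
        then show "p s n = 0"
          using that by (auto simp: p_def)
      qed auto
      then have "(\<Sum>n<k J. x n * z ^ n) = (\<Sum>n<k J. \<Sum>s<J. p s n * y ^ n)"
        by (intro sum.cong)
           (auto simp: x_def y_def power_mult_distrib sum_distrib_left mult_ac)
      also have "\<dots> = (\<Sum>s<J. \<Sum>n<k J. p s n * y ^ n)"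
        by (rule sum.swap)
      also have "norm \<dots> \<le> (\<Sum>s<J. (1 / 2) ^ s * (K * exp (omega M (norm y))))"
        by (rule sum_norm_le) (auto intro: block)
      also have "\<dots> \<le> 2 * (K * exp (omega M (norm y)))"
        unfolding sum_distrib_right[symmetric]
        using half[of "{..<J}"] \<open>K \<ge> 1\<close> by (intro mult_right_mono) auto
      finally show ?thesis by (simp add: mult.assoc)
    qed
    have "(\<lambda>J. \<Sum>n<k J. x n * z ^ n) \<longlonglongrightarrow> (\<Sum>n. x n * z ^ n)"
      using LIMSEQ_subseq_LIMSEQ[OF summable_LIMSEQ[OF summable_x] mono_k] by (simp add: o_def)
    then have "norm (\<Sum>n. x n * z ^ n) \<le> 2 * K * exp (omega M (norm y))"
      using partial by (intro Lim_norm_ubound[OF _ _ always_eventually]) auto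
    then show ?thesis
      using \<open>c > 0\<close> by (simp add: y_def norm_mult)
  qed
  then have "x \<in> taylor_coeffs ` H_infty (weight M c)"
    unfolding taylor_coeffs_H_infty_weight_iff using summable_x by blast
  then have "(\<lambda>n. of_real (norm (x n))) \<in> taylor_coeffs ` H_infty (weight M c)"
    using solid unfolding solid_def by (elim allE[of _ x] allE[of _ "\<lambda>n. of_real (norm (x n))"]) simp
  then obtain C where summable_abs: "\<And>z. summable (\<lambda>n. complex_of_real (norm (x n)) * z ^ n)"
    and C: "\<And>z. norm (\<Sum>n. complex_of_real (norm (x n)) * z ^ n) \<le> C * exp (omega M (c * norm z))"
    unfolding taylor_coeffs_H_infty_weight_iff by blast
  have "(81 / 50) ^ s \<le> C" for s
  proof -
    define r where "r = t s / c"
    have "r > 0" using t_pos[of s] \<open>c > 0\<close> by (simp add: r_def)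
    have "summable (\<lambda>n. norm (x n) * r ^ n)"
      using summable_abs[of "of_real r"] by (simp flip: of_real_power of_real_mult add: summable_of_real_iff)
    have omega: "exp (omega M (t s)) = t s ^ k s / M (k s)"
      unfolding t_def using monoD[OF mono_S, of "k s" "Suc (k s)"]
      by (intro exp_omega_eq_maximal_term) auto
    have coeff: "norm (x n) * r ^ n = (1 / 50) ^ s * (t s ^ k s / M (k s))"
      if n: "n \<in> {k s..<k s + 81 ^ s}" for n
    proof -
      have "p s' n = 0" if "s' \<noteq> s" for s'
      proof (cases "s' < s")
        case True
        then have "k (Suc s') \<le> k s"
          using strict_mono_mono[OF mono_k] by (intro monoD[of k]) auto
        then show ?thesis
          using n long[of s'] ordered[of s'] by (auto simp: p_def)
      next
        case False
        then have "k (Suc s) \<le> k s'"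
          using that strict_mono_mono[OF mono_k] by (intro monoD[of k]) auto
        then show ?thesis
          using n long[of s] ordered[of s] by (auto simp: p_def)
      qed
      moreover have "s \<le> n"
        using n strict_mono_imp_increasing[OF mono_k, of s] by auto
      ultimately have "(\<Sum>s'\<le>n. p s' n) = p s n"
        using sum.mono_neutral_right[of "{..n}" "{s}" "\<lambda>s'. p s' n"] by auto
      then have "norm (x n) * r ^ n = norm (p s n) * t s ^ n"
        using \<open>c > 0\<close> by (simp add: x_def r_def norm_mult norm_power power_divide)
      then show ?thesis
        using t_pos[of s] by (simp add: norm_p[OF n] power_one_over)
    qed
    have "81 ^ s * ((1 / 50) ^ s * (t s ^ k s / M (k s)))
        = (\<Sum>n = k s..<k s + 81 ^ s. norm (x n) * r ^ n)"
      by (simp add: coeff)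
    also have "\<dots> \<le> (\<Sum>n. norm (x n) * r ^ n)"
      using \<open>r > 0\<close> by (intro sum_le_suminf \<open>summable (\<lambda>n. norm (x n) * r ^ n)\<close>) auto
    also have "\<dots> \<le> norm (\<Sum>n. complex_of_real (norm (x n)) * of_real r ^ n)"
    proof -
      have "(\<Sum>n. complex_of_real (norm (x n)) * of_real r ^ n)
          = of_real (\<Sum>n. norm (x n) * r ^ n)"
        using suminf_of_real[OF \<open>summable (\<lambda>n. norm (x n) * r ^ n)\<close>, where 'a = complex] by simp
      then show ?thesis by simp
    qed
    also have "\<dots> \<le> C * (t s ^ k s / M (k s))"
    proof -
      have "c * norm (complex_of_real r) = t s"
        using \<open>c > 0\<close> t_pos[of s] by (simp add: r_def norm_divide)
      then show ?thesis
        using C[of "of_real r"] omega by simp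
    qed
    finally have "81 ^ s * (1 / 50) ^ s * (t s ^ k s / M (k s)) \<le> C * (t s ^ k s / M (k s))"
      by (simp add: mult.assoc)
    then have "81 ^ s * (1 / 50) ^ s \<le> C"
      by (rule mult_right_le_imp_le) (use t_pos M_pos in simp)
    then show ?thesis
      by (simp add: power_divide)
  qed
  moreover obtain s where "(81 / 50 :: real) ^ s > C"
    using real_arch_pow[of "81 / 50" C] by auto
  ultimately show False
    by (metis not_le)
qed

section \<open>Lusky numbers in logarithmic form\<close>

lemma prod_quot_seq:
  "(\<Prod>i=k+1..l. quot_seq M i) = (\<Prod>i<l - k. exp (S (Suc (k + i))))"
  by (rule prod.reindex_bij_witness[of _ "\<lambda>i. Suc (k + i)" "\<lambda>i. i - Suc k"])
     (auto simp: quot_seq_eq)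

lemma lusky_A_eq: "lusky_A M k l = exp (\<Sum>i<l - k. S (Suc l) - S (Suc (k + i)))"
  unfolding lusky_A_def prod_quot_seq
  by (simp add: quot_seq_eq exp_sum exp_diff prod_dividef)

lemma lusky_B_eq: "lusky_B M k l = exp (\<Sum>i<l - k. S (Suc (k + i)) - S (Suc k))"
  unfolding lusky_B_def prod_quot_seq
  by (simp add: quot_seq_eq exp_sum exp_diff prod_dividef)

text \<open>\<open>lusky_B M k l\<close> is the factor by which \<open>M l\<close> exceeds its tangent at \<open>k\<close>.\<close>

lemma M_eq_lusky_B:
  assumes "k \<le> l"
  shows "M l = lusky_B M k l * (M k * exp (S (Suc k)) ^ (l - k))"
proof -
  have "M (k + n) = M k * (\<Prod>i<n. exp (S (Suc (k + i))))" for n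
    by (induction n) (simp_all add: M_Suc)
  from this[of "l - k"] show ?thesis
    using assms unfolding lusky_B_def prod_quot_seq by (simp add: quot_seq_eq)
qed

lemma lusky_numbers_bounds:
  assumes "lusky_numbers M a"
  shows "\<exists>K. \<forall>j\<ge>1. lusky_A M (a j) (a (j + 1)) \<le> K \<and>
    2 < lusky_B M (a j) (a (j + 1)) \<and> lusky_B M (a j) (a (j + 1)) \<le> K"
  using assms unfolding lusky_numbers_def by (meson less_le_trans max.boundedE min.boundedE)

text \<open>A gap of 1 would give \<open>lusky_B = 1\<close>, but Lusky numbers require more than 2.\<close>

lemma lusky_numbers_gap_ge_2:
  assumes "lusky_numbers M a" "j \<ge> 1"
  shows "a j + 2 \<le> a (j + 1)"
proof (rule ccontr)
  assume "\<not> a j + 2 \<le> a (j + 1)"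
  then have "a (j + 1) - a j = 0 \<or> a (j + 1) - a j = Suc 0"
    by linarith
  then have "lusky_B M (a j) (a (j + 1)) = 1"
    unfolding lusky_B_eq by auto
  moreover have "2 < lusky_B M (a j) (a (j + 1))"
    using lusky_numbers_bounds[OF assms(1)] \<open>j \<ge> 1\<close> by blast
  ultimately show False
    by simp
qed

lemma lusky_numbers_log_A_bounded:
  assumes "lusky_numbers M a"
  shows "\<exists>\<kappa>. \<forall>j\<ge>1.
    (\<Sum>i<a (j + 1) - a j. S (Suc (a (j + 1))) - S (Suc (a j + i))) \<le> \<kappa>"
proof -
  obtain K where K: "\<forall>j\<ge>1. lusky_A M (a j) (a (j + 1)) \<le> K"
    using lusky_numbers_bounds[OF assms] by blast
  have "(\<Sum>i<a (j + 1) - a j. S (Suc (a (j + 1))) - S (Suc (a j + i))) \<le> K" if "j \<ge> 1" for j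
  proof -
    have "exp (\<Sum>i<a (j + 1) - a j. S (Suc (a (j + 1))) - S (Suc (a j + i))) \<le> K"
      using K that unfolding lusky_A_eq by blast
    then show ?thesis
      using exp_ge_add_one_self[of "\<Sum>i<a (j + 1) - a j. S (Suc (a (j + 1))) - S (Suc (a j + i))"]
      by linarith
  qed
  then show ?thesis by blast
qed

lemma lusky_numbers_log_B_ge:
  assumes "lusky_numbers M a" "j \<ge> 1"
  shows "ln 2 \<le> (\<Sum>i<a (j + 1) - a j. S (Suc (a j + i)) - S (Suc (a j)))"
proof -
  have "2 < lusky_B M (a j) (a (j + 1))"
    using lusky_numbers_bounds[OF assms(1)] \<open>j \<ge> 1\<close> by blast
  then have "exp (ln 2) \<le> lusky_B M (a j) (a (j + 1))"
    by simp
  then show ?thesis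
    unfolding lusky_B_eq by (simp only: exp_le_cancel_iff)
qed

lemma lusky_numbers_ge:
  assumes "lusky_numbers M a"
  shows "j \<le> a (Suc j)"
proof (induction j)
  case (Suc j)
  have "a (Suc j) < a (Suc (Suc j))"
    using assms by (auto simp: lusky_numbers_def intro: strict_mono_onD)
  then show ?case using Suc by simp
qed simp

lemma lusky_numbers_mono:
  assumes "lusky_numbers M a" "1 \<le> i" "i \<le> j"
  shows "a i \<le> a j"
  using assms by (auto simp: lusky_numbers_def intro: strict_mono_on_leD)

text \<open>Every increment of \<open>S\<close> beyond \<open>a 1\<close> falls between two consecutive Lusky numbers, where it is dominated
  by one summand of the logarithm of \<open>lusky_A\<close>.\<close>

lemma increments_bounded_if_lusky_numbers:
  assumes lusky: "lusky_numbers M a"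
  shows "\<exists>C. \<forall>n. S (Suc n) - S n \<le> C"
proof -
  note gap = lusky_numbers_gap_ge_2[OF lusky]
  obtain \<kappa> where A: "\<forall>j\<ge>1. (\<Sum>i<a (j + 1) - a j. S (Suc (a (j + 1))) - S (Suc (a j + i))) \<le> \<kappa>"
    using lusky_numbers_log_A_bounded[OF lusky] by blast
  have "S (Suc n) - S n \<le> max (S (Suc (a 1))) \<kappa>" for n
  proof (cases "n \<le> a 1")
    case True
    then have "S (Suc n) \<le> S (Suc (a 1))" "S 0 \<le> S n"
      by (auto intro: monoD[OF mono_S])
    then show ?thesis by (simp add: S_0 max_def)
  next
    case False
    define j where "j = (LEAST j. n \<le> a (Suc j))"
    have "\<exists>j. n \<le> a (Suc j)"
      using lusky_numbers_ge[OF lusky] by blast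
    then have "n \<le> a (Suc j)"
      unfolding j_def by (rule LeastI_ex)
    with False obtain j' where j': "j = Suc j'" by (cases j) auto
    then have "a j < n"
      using not_less_Least[of j' "\<lambda>j. n \<le> a (Suc j)"] by (simp add: j_def[symmetric])
    define i where "i = n - Suc (a j)"
    have i: "n = Suc (a j + i)" "i < a (j + 1) - a j"
      using \<open>a j < n\<close> \<open>n \<le> a (Suc j)\<close> by (auto simp: i_def)
    have "S (Suc n) - S n \<le> S (Suc (a (j + 1))) - S (Suc (a j + i))"
      using \<open>n \<le> a (Suc j)\<close> monoD[OF mono_S, of "Suc n"] by (simp add: i)
    also have "\<dots> \<le> (\<Sum>i<a (j + 1) - a j. S (Suc (a (j + 1))) - S (Suc (a j + i)))"
      using i(2) by (intro member_le_sum) (auto intro!: monoD[OF mono_S])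
    also have "\<dots> \<le> \<kappa>"
      using A j' by simp
    finally show ?thesis by simp
  qed
  then show ?thesis by blast
qed

text \<open>In the moderate growth condition with both indices equal to \<open>n\<close>, the logarithm of \<open>M (2 * n) / (M n)\<^sup>2\<close>
  contains the increment \<open>S (Suc n) - S n\<close> at least \<open>n\<close> times, and it is at most \<open>2 * n * ln C\<close>.\<close>

lemma increments_bounded_if_moderate_growth:
  assumes "moderate_growth M"
  shows "\<exists>C. \<forall>n. S (Suc n) - S n \<le> C"
proof -
  obtain C where "C \<ge> 1" and mg: "\<And>j k. M (j + k) \<le> C ^ (j + k) * M j * M k"
    using assms unfolding moderate_growth_def by blast
  have "S (Suc n) - S n \<le> max (C\<^sup>2) (S 1)" for n
  proof (cases n)
    case 0
    then show ?thesis by (simp add: S_0)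
  next
    case (Suc n')
    have "M n * exp (S (Suc n)) ^ n \<le> M (n + n)"
      using M_growth_ge[of n "n + n" "S (Suc n)"] by simp
    also have "\<dots> \<le> C ^ (n + n) * M n * M n" by (rule mg)
    finally have "M n * exp (S (Suc n)) ^ n \<le> M n * (C ^ (n + n) * M n)"
      by (simp add: mult_ac)
    then have "exp (S (Suc n)) ^ n \<le> C ^ (n + n) * M n"
      using M_pos[of n] by simp
    also have "\<dots> \<le> C ^ (n + n) * exp (S n) ^ n"
      using M_growth_le[of 0 n "S n"] \<open>C \<ge> 1\<close> by (intro mult_left_mono) (auto simp: M_0)
    also have "C ^ (n + n) = (C\<^sup>2) ^ n"
      by (simp flip: power_mult add: mult_2)
    finally have "exp (S (Suc n) - S n) ^ Suc n' \<le> (C\<^sup>2) ^ Suc n'"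
      using Suc by (simp add: exp_diff power_divide divide_le_eq)
    then have "exp (S (Suc n) - S n) \<le> C\<^sup>2"
      by (rule power_le_imp_le_base) simp
    then have "S (Suc n) - S n \<le> C\<^sup>2"
      using exp_ge_add_one_self[of "S (Suc n) - S n"] by linarith
    then show ?thesis by (rule max.coboundedI1)
  qed
  then show ?thesis by blast
qed

text \<open>Each summand of the logarithm of \<open>lusky_A\<close> contains the last increment of its block.\<close>

lemma last_increment_times_gap_bounded:
  assumes lusky: "lusky_numbers M a"
  shows "\<exists>C. \<forall>j\<ge>1.
    (S (Suc (a (j + 1))) - S (a (j + 1))) * (real (a (j + 1)) - real (a j)) \<le> C"
proof -
  note gap = lusky_numbers_gap_ge_2[OF lusky]
  obtain \<kappa> where A: "\<forall>j\<ge>1. (\<Sum>i<a (j + 1) - a j. S (Suc (a (j + 1))) - S (Suc (a j + i))) \<le> \<kappa>"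
    using lusky_numbers_log_A_bounded[OF lusky] by blast
  have "(S (Suc (a (j + 1))) - S (a (j + 1))) * (real (a (j + 1)) - real (a j)) \<le> \<kappa>"
    if j: "j \<ge> 1" for j
  proof -
    define L where "L = a (j + 1) - a j"
    have "(S (Suc (a (j + 1))) - S (a (j + 1))) * (real (a (j + 1)) - real (a j))
        = (\<Sum>i<L. S (Suc (a (j + 1))) - S (a (j + 1)))"
      using gap[OF j] by (simp add: L_def of_nat_diff)
    also have "\<dots> \<le> (\<Sum>i<L. S (Suc (a (j + 1))) - S (Suc (a j + i)))"
      by (intro sum_mono diff_left_mono monoD[OF mono_S]) (auto simp: L_def)
    also have "\<dots> \<le> \<kappa>" using A j unfolding L_def by blast
    finally show ?thesis .
  qed
  then show ?thesis by blast
qed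

section \<open>Solidity and the gaps between Lusky numbers\<close>

text \<open>Since \<open>lusky_B > 2\<close>, the sequence \<open>S\<close> gains at least \<open>ln 2 / L\<close> within every block of length at most \<open>L\<close>,
  and a window of length \<open>a 1 + 2 * L\<close> contains a complete block wherever it starts.\<close>

lemma separated_if_bounded_gaps:
  assumes lusky: "lusky_numbers M a" and L: "\<And>j. j \<ge> 1 \<Longrightarrow> a (j + 1) \<le> a j + L"
  shows "\<exists>\<eta>>0. \<exists>q. \<forall>n. S n + \<eta> \<le> S (n + q)"
proof -
  note gap = lusky_numbers_gap_ge_2[OF lusky] and B = lusky_numbers_log_B_ge[OF lusky]
  have "L > 0" using gap[of 1] L[of 1] by simp
  define \<eta> where "\<eta> = ln 2 / real L"
  have "\<eta> > 0" using \<open>L > 0\<close> by (simp add: \<eta>_def)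
  moreover have "S n + \<eta> \<le> S (n + (a 1 + 2 * L))" for n
  proof -
    define j where "j = (LEAST j. n \<le> a (Suc j))"
    have "\<exists>j. n \<le> a (Suc j)"
      using lusky_numbers_ge[OF lusky] by blast
    then have ge: "n \<le> a (Suc j)"
      unfolding j_def by (rule LeastI_ex)
    have le: "a (Suc j) \<le> n + a 1 + L"
    proof (cases j)
      case (Suc j')
      then have "a j < n"
        using not_less_Least[of j' "\<lambda>j. n \<le> a (Suc j)"] by (simp add: j_def[symmetric])
      then show ?thesis using L[of j] Suc by simp
    qed simp
    define k l where "k = a (Suc j)" and "l = a (Suc (Suc j))"
    have kl: "k < l" "l \<le> k + L"
      using gap[of "Suc j"] L[of "Suc j"] by (auto simp: k_def l_def)
    have "ln 2 \<le> (\<Sum>i<l - k. S (Suc (k + i)) - S (Suc k))"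
      using B[of "Suc j"] by (simp add: k_def l_def)
    also have "\<dots> \<le> (\<Sum>i<l - k. S l - S (Suc k))"
      by (intro sum_mono diff_right_mono monoD[OF mono_S]) auto
    also have "\<dots> = real (l - k) * (S l - S (Suc k))"
      by simp
    also have "\<dots> \<le> real L * (S l - S (Suc k))"
      using kl monoD[OF mono_S, of "Suc k" l] by (intro mult_right_mono) auto
    finally have "\<eta> \<le> S l - S (Suc k)"
      using \<open>L > 0\<close> by (simp add: \<eta>_def divide_le_eq mult.commute)
    moreover have "S n \<le> S (Suc k)" "S l \<le> S (n + (a 1 + 2 * L))"
      using ge le kl by (auto intro!: monoD[OF mono_S] simp: k_def)
    ultimately show ?thesis by linarith
  qed
  ultimately show ?thesis by blast
qed

lemma solid_if_separated:
  assumes "c > 0" "\<eta> > 0" "\<And>n. S n + \<eta> \<le> S (n + q)"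
  shows "solid (taylor_coeffs ` H_infty (weight M c))"
  using sum_le_exp_omega_if_separated[OF assms(2,3)] solid_if_sum_le_exp_omega[OF \<open>c > 0\<close>] by blast

text \<open>Long gaps occur arbitrarily late, which allows the choice of a sequence of disjoint blocks whose lengths
  grow as fast as the construction of the counterexample demands.\<close>

lemma not_solid_if_unbounded_gaps:
  assumes "c > 0" and lusky: "lusky_numbers M a"
    and unbounded: "\<And>L. \<exists>j\<ge>1. a (j + 1) > a j + L"
  shows "\<not> solid (taylor_coeffs ` H_infty (weight M c))"
proof -
  note gap = lusky_numbers_gap_ge_2[OF lusky]
  obtain K where B: "\<forall>j\<ge>1. lusky_B M (a j) (a (j + 1)) \<le> K"
    using lusky_numbers_bounds[OF lusky] by blast
  have later: "\<exists>j>j0. a (j + 1) > a j + L" for j0 L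
  proof -
    obtain j where "j \<ge> 1" and j: "a (j + 1) > a j + (L + a (j0 + 1))"
      using unbounded by blast
    have "j > j0"
    proof (rule ccontr)
      assume "\<not> j > j0"
      then have "a (j + 1) \<le> a (j0 + 1)"
        by (intro lusky_numbers_mono[OF lusky]) auto
      with j show False by simp
    qed
    with j show ?thesis by auto
  qed
  have "\<exists>\<sigma>. \<forall>s. (\<sigma> s \<ge> 1 \<and> a (\<sigma> s) + 81 ^ s \<le> a (\<sigma> s + 1)) \<and> \<sigma> s < \<sigma> (Suc s)"
  proof (rule dependent_nat_choice)
    show "\<exists>j. j \<ge> 1 \<and> a j + 81 ^ 0 \<le> a (j + 1)"
      using gap[of 1] by (intro exI[of _ 1]) simp
    show "\<exists>j'. (j' \<ge> 1 \<and> a j' + 81 ^ Suc s \<le> a (j' + 1)) \<and> j < j'" for j s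
    proof -
      obtain j' where "j' > j" "a (j' + 1) > a j' + 81 ^ Suc s"
        using later by blast
      then show ?thesis
        by (intro exI[of _ j']) linarith
    qed
  qed
  then obtain \<sigma> where pos: "\<And>s. \<sigma> s \<ge> 1" and long: "\<And>s. a (\<sigma> s) + 81 ^ s \<le> a (\<sigma> s + 1)"
    and less: "\<And>s. \<sigma> s < \<sigma> (Suc s)"
    by blast
  show ?thesis
  proof (rule not_solid_if_long_blocks[where k = "\<lambda>s. a (\<sigma> s)" and l = "\<lambda>s. a (\<sigma> s + 1)"])
    show "a (\<sigma> s + 1) \<le> a (\<sigma> (Suc s))" for s
      using less[of s] by (intro lusky_numbers_mono[OF lusky]) auto
    show "M (a (\<sigma> s + 1)) \<le> K *
        (M (a (\<sigma> s)) * exp (S (Suc (a (\<sigma> s)))) ^ (a (\<sigma> s + 1) - a (\<sigma> s)))" for s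
      using gap[OF pos[of s]] B pos[of s] M_pos
      by (subst M_eq_lusky_B[of "a (\<sigma> s)"]) (auto intro!: mult_right_mono simp: less_imp_le)
  qed (use \<open>c > 0\<close> long in auto)
qed

lemma solid_iff_bounded_gaps:
  assumes "c > 0" and lusky: "lusky_numbers M a"
  shows "solid (taylor_coeffs ` H_infty (weight M c)) \<longleftrightarrow> (\<exists>L. \<forall>j\<ge>1. a (j + 1) \<le> a j + L)"
proof
  assume "\<exists>L. \<forall>j\<ge>1. a (j + 1) \<le> a j + L"
  then obtain L where "\<And>j. j \<ge> 1 \<Longrightarrow> a (j + 1) \<le> a j + L" by blast
  from separated_if_bounded_gaps[OF lusky this]
  obtain \<eta> q where "\<eta> > 0" "\<And>n. S n + \<eta> \<le> S (n + q)" by blast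
  then show "solid (taylor_coeffs ` H_infty (weight M c))"
    by (rule solid_if_separated[OF \<open>c > 0\<close>])
next
  assume "solid (taylor_coeffs ` H_infty (weight M c))"
  then show "\<exists>L. \<forall>j\<ge>1. a (j + 1) \<le> a j + L"
    using not_solid_if_unbounded_gaps[OF assms] by (meson not_le)
qed

lemma separated_if_increments_eventually_ge:
  assumes "\<And>n. n \<ge> N \<Longrightarrow> \<epsilon> \<le> S (Suc n) - S n"
  shows "S n + \<epsilon> \<le> S (n + Suc N)"
  using assms[of "n + N"] monoD[OF mono_S, of n "n + N"] by simp

text \<open>The gap times the increment just after it is bounded, and that increment is at least \<open>\<epsilon>\<close> for all but
  finitely many gaps.\<close>

lemma gaps_bounded_if_increments_eventually_ge:
  assumes lusky: "lusky_numbers M a" and "\<epsilon> > 0" and \<epsilon>: "\<And>n. n \<ge> N \<Longrightarrow> \<epsilon> \<le> S (Suc n) - S n"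
  shows "\<exists>C. \<forall>j\<ge>1. real (a (j + 1)) - real (a j) \<le> C"
proof -
  obtain C where C: "\<forall>j\<ge>1.
      (S (Suc (a (j + 1))) - S (a (j + 1))) * (real (a (j + 1)) - real (a j)) \<le> C"
    using last_increment_times_gap_bounded[OF lusky] by blast
  have "real (a (j + 1)) - real (a j) \<le> max (C / \<epsilon>) (real (a (N + 1)))" if j: "j \<ge> 1" for j
  proof (cases "N \<le> j")
    case True
    then have "\<epsilon> \<le> S (Suc (a (j + 1))) - S (a (j + 1))"
      using lusky_numbers_ge[OF lusky, of j] by (intro \<epsilon>) simp
    then have "\<epsilon> * (real (a (j + 1)) - real (a j))
        \<le> (S (Suc (a (j + 1))) - S (a (j + 1))) * (real (a (j + 1)) - real (a j))"
      using lusky_numbers_mono[OF lusky j, of "j + 1"] by (intro mult_right_mono) auto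
    also have "\<dots> \<le> C" using C j by blast
    finally have "real (a (j + 1)) - real (a j) \<le> C / \<epsilon>"
      using \<open>\<epsilon> > 0\<close> by (simp add: le_divide_eq mult.commute)
    then show ?thesis
      by (rule max.coboundedI1)
  next
    case False
    then have "a (j + 1) \<le> a (N + 1)"
      by (intro lusky_numbers_mono[OF lusky]) auto
    then show ?thesis by (simp add: max_def)
  qed
  then show ?thesis by blast
qed

section \<open>Increments between two positive bounds\<close>

text \<open>For a gap \<open>L\<close> the logarithms of \<open>lusky_A\<close> and \<open>lusky_B\<close> lie between \<open>d1\<close> and \<open>d2\<close> times the triangular
  numbers \<open>L (L + 1) / 2\<close> and \<open>L (L - 1) / 2\<close>. The two hypotheses on \<open>C1\<close> make both logarithms at least 1,
  and \<open>exp 1 > 2\<close> is the required lower bound.\<close>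

lemma lusky_numbers_if_increments_between:
  fixes a :: "nat \<Rightarrow> nat" and d1 d2 C1 C2 :: real
  assumes d: "0 < d1" "\<And>n. d1 \<le> S (Suc n) - S n" "\<And>n. S (Suc n) - S n \<le> d2"
    and C: "2 \<le> C1"
    and gap: "\<And>j. j \<ge> 1 \<Longrightarrow> C1 \<le> real (a (j + 1)) - real (a j)"
      "\<And>j. j \<ge> 1 \<Longrightarrow> real (a (j + 1)) - real (a j) \<le> C2"
    and A: "2 \<le> d1 * C1 * (1 + C1)" and B: "2 \<le> d1 * C1 * (C1 - 1)"
  shows "lusky_numbers M a"
proof -
  have gauss: "(\<Sum>i<L. real i) = real L * (real L - 1) / 2" for L
    by (induction L) (auto simp: field_simps)
  have gauss': "(\<Sum>i<L. real L - real i) = real L * (real L + 1) / 2" for L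
    unfolding sum_subtractf gauss by (simp add: field_simps)
  have lower: "d1 * real i \<le> S (m + i) - S m" for m i
  proof (induction i)
    case (Suc i)
    then show ?case using d(2)[of "m + i"] by (simp add: algebra_simps)
  qed simp
  have upper: "S (m + i) - S m \<le> d2 * real i" for m i
  proof (induction i)
    case (Suc i)
    then show ?case using d(3)[of "m + i"] by (simp add: algebra_simps)
  qed simp
  have "d1 \<le> d2" using d(2)[of 0] d(3)[of 0] by simp
  then have "d2 > 0" using d(1) by simp
  define K where "K = exp (d2 * (C2 * (C2 + 1) / 2))"
  have bounds: "exp 1 \<le> lusky_A M (a j) (a (j + 1)) \<and> lusky_A M (a j) (a (j + 1)) \<le> K \<and>
      exp 1 \<le> lusky_B M (a j) (a (j + 1)) \<and> lusky_B M (a j) (a (j + 1)) \<le> K"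
    if j: "j \<ge> 1" for j
  proof -
    define k L where "k = a j" and "L = a (j + 1) - a j"
    have l: "a (j + 1) = k + L" and L: "C1 \<le> real L" "real L \<le> C2"
      using gap[OF j] C by (auto simp: k_def L_def)
    have "L \<ge> 2" using L C by linarith
    have large: "real L * (real L + 1) \<le> C2 * (C2 + 1)"
      using L C by (intro mult_mono) auto
    have "C1 * (1 + C1) \<le> real L * (real L + 1)"
      using L C by (intro mult_mono) auto
    then have "d1 * (C1 * (1 + C1)) \<le> d1 * (real L * (real L + 1))"
      using d(1) by simp
    with A have A': "2 \<le> d1 * (real L * (real L + 1))"
      by (simp add: mult.assoc)
    have "C1 * (C1 - 1) \<le> real L * (real L - 1)"
      using L C by (intro mult_mono) auto
    then have "d1 * (C1 * (C1 - 1)) \<le> d1 * (real L * (real L - 1))"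
      using d(1) by simp
    with B have B': "2 \<le> d1 * (real L * (real L - 1))"
      by (simp add: mult.assoc)
    have logA: "lusky_A M (a j) (a (j + 1)) = exp (\<Sum>i<L. S (Suc (k + L)) - S (Suc (k + i)))"
      unfolding lusky_A_eq l by (simp add: k_def)
    have logB: "lusky_B M (a j) (a (j + 1)) = exp (\<Sum>i<L. S (Suc (k + i)) - S (Suc k))"
      unfolding lusky_B_eq l by (simp add: k_def)
    have tail: "d1 * (real L - real i) \<le> S (Suc (k + L)) - S (Suc (k + i))"
      "S (Suc (k + L)) - S (Suc (k + i)) \<le> d2 * (real L - real i)" if "i < L" for i
    proof -
      have "Suc (k + i) + (L - i) = Suc (k + L)" using that by simp
      then show "d1 * (real L - real i) \<le> S (Suc (k + L)) - S (Suc (k + i))"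
        "S (Suc (k + L)) - S (Suc (k + i)) \<le> d2 * (real L - real i)"
        using lower[of "L - i" "Suc (k + i)"] upper[of "Suc (k + i)" "L - i"] that
        by (simp_all only: of_nat_diff less_imp_le)
    qed
    have "1 \<le> d1 * (\<Sum>i<L. real L - real i)"
      unfolding gauss' using A' by simp
    also have "\<dots> \<le> (\<Sum>i<L. S (Suc (k + L)) - S (Suc (k + i)))"
      unfolding sum_distrib_left
      by (rule sum_mono) (use tail(1) in auto)
    finally have 1: "exp 1 \<le> lusky_A M (a j) (a (j + 1))"
      unfolding logA by (simp only: exp_le_cancel_iff)
    have "(\<Sum>i<L. S (Suc (k + L)) - S (Suc (k + i))) \<le> d2 * (\<Sum>i<L. real L - real i)"
      unfolding sum_distrib_left
      by (rule sum_mono) (use tail(2) in auto)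
    also have "\<dots> \<le> d2 * (C2 * (C2 + 1) / 2)"
      unfolding gauss' using large \<open>d2 > 0\<close> by simp
    finally have 2: "lusky_A M (a j) (a (j + 1)) \<le> K"
      unfolding logA K_def by (simp only: exp_le_cancel_iff)
    have "1 \<le> d1 * (\<Sum>i<L. real i)"
      unfolding gauss using B' by simp
    also have "\<dots> \<le> (\<Sum>i<L. S (Suc (k + i)) - S (Suc k))"
      unfolding sum_distrib_left
      by (rule sum_mono) (use lower[of _ "Suc k"] in auto)
    finally have 3: "exp 1 \<le> lusky_B M (a j) (a (j + 1))"
      unfolding logB by (simp only: exp_le_cancel_iff)
    have "(\<Sum>i<L. S (Suc (k + i)) - S (Suc k)) \<le> d2 * (\<Sum>i<L. real i)"
      unfolding sum_distrib_left
      by (rule sum_mono) (use upper[of "Suc k"] in auto)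
    also have "\<dots> \<le> d2 * (\<Sum>i<L. real L - real i)"
      unfolding gauss gauss' using \<open>d2 > 0\<close> by (intro mult_left_mono) (auto simp: field_simps)
    also have "\<dots> \<le> d2 * (C2 * (C2 + 1) / 2)"
      unfolding gauss' using large \<open>d2 > 0\<close> by simp
    finally have 4: "lusky_B M (a j) (a (j + 1)) \<le> K"
      unfolding logB K_def by (simp only: exp_le_cancel_iff)
    from 1 2 3 4 show ?thesis by simp
  qed
  have "a (Suc n) < a (Suc (Suc n))" for n
    using gap(1)[of "Suc n"] C by simp
  then have strict: "strict_mono (\<lambda>j. a (Suc j))"
    by (rule strict_monoI_Suc)
  have "strict_mono_on {1..} a"
  proof (rule strict_mono_onI)
    fix r s :: nat assume "r \<in> {1..}" "r < s"
    then show "a r < a s"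
      using strict_monoD[OF strict, of "r - 1" "s - 1"] by simp
  qed
  moreover have "exp 1 > (2 :: real)"
    using exp_lower_Taylor_quadratic[of "1 :: real"] by simp
  moreover have "exp 1 \<le> K"
    using bounds[of 1] by simp
  ultimately show ?thesis
    unfolding lusky_numbers_def using bounds by (intro conjI exI[of _ K] exI[of _ "exp 1"]) auto
qed

end

section \<open>The theorem\<close>

lemma SUP_ereal_less_infinity_iff:
  fixes f :: "'a \<Rightarrow> real"
  shows "(SUP j\<in>A. ereal (f j)) < \<infinity> \<longleftrightarrow> (\<exists>C. \<forall>j\<in>A. f j \<le> C)"
proof
  assume "(SUP j\<in>A. ereal (f j)) < \<infinity>"
  then obtain n :: nat where "(SUP j\<in>A. ereal (f j)) < ereal (real n)"
    using less_PInf_Ex_of_nat by (auto simp: less_top[symmetric] top_ereal_def)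
  then have "\<forall>j\<in>A. f j \<le> real n"
    by (metis SUP_lessD ereal_less_le less_ereal.simps(1) less_imp_le)
  then show "\<exists>C. \<forall>j\<in>A. f j \<le> C" ..
next
  assume "\<exists>C. \<forall>j\<in>A. f j \<le> C"
  then obtain C where "\<And>j. j \<in> A \<Longrightarrow> f j \<le> C" by blast
  then have "(SUP j\<in>A. ereal (f j)) \<le> ereal C"
    by (intro SUP_least) simp
  then show "(SUP j\<in>A. ereal (f j)) < \<infinity>"
    using le_less_trans by fastforce
qed

theorem lemma5p4:
  fixes \<delta> :: "nat \<Rightarrow> real" and M :: "nat \<Rightarrow> real"
  assumes delta_nonneg: "\<And>p. p \<ge> 1 \<Longrightarrow> \<delta> p \<ge> 0"
    and delta_diverges: "filterlim (\<lambda>n. \<Sum>p=1..n. \<delta> p) at_top sequentially"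
    and M_eq: "\<And>p. M p = (\<Prod>i=1..p. exp (\<Sum>j=1..i. \<delta> j))"
  shows
    "M \<in> LC
   \<and> \<comment> \<open>(i)\<close>
     ((SUP p\<in>{1..}. ereal (\<delta> p)) = \<infinity> \<longrightarrow>
        \<not> moderate_growth M
      \<and> \<not> (\<exists>a. (\<forall>j\<ge>1. a j > 0) \<and> lusky_numbers M a))
   \<and> \<comment> \<open>(ii)\<close>
     (limsup (\<lambda>p. ereal (\<delta> p)) < \<infinity> \<longrightarrow>
        (\<forall>a. lusky_numbers M a \<longrightarrow>
           (SUP j\<in>{1..}. ereal (\<delta> (a (j + 1) + 1) * (real (a (j + 1)) - real (a j)))) < \<infinity>
         \<and> ((SUP j\<in>{1..}. ereal (real (a (j + 1)) - real (a j))) < \<infinity> \<longleftrightarrow>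
              (\<exists>C::real. C \<ge> 2 \<and>
                 (\<forall>j\<ge>1. 2 \<le> real (a (j + 1)) - real (a j) \<and> real (a (j + 1)) - real (a j) \<le> C)))
         \<and> (\<forall>c>0. (SUP j\<in>{1..}. ereal (real (a (j + 1)) - real (a j))) < \<infinity> \<longleftrightarrow>
              solid (taylor_coeffs ` H_infty (weight M c))))
      \<and> (liminf (\<lambda>p. ereal (\<delta> p)) > 0 \<longrightarrow>
           (\<forall>a. lusky_numbers M a \<longrightarrow>
              (SUP j\<in>{1..}. ereal (real (a (j + 1)) - real (a j))) < \<infinity>
            \<and> (\<exists>C::real. C \<ge> 2 \<and>
                 (\<forall>j\<ge>1. 2 \<le> real (a (j + 1)) - real (a j) \<and> real (a (j + 1)) - real (a j) \<le> C)))
         \<and> (\<forall>c>0. solid (taylor_coeffs ` H_infty (weight M c)))))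
   \<and> \<comment> \<open>(iii)\<close>
     (\<forall>d\<^sub>1 d\<^sub>2 :: real. 0 < d\<^sub>1 \<and> d\<^sub>1 \<le> d\<^sub>2 \<and> (\<forall>p\<ge>1. d\<^sub>1 \<le> \<delta> p \<and> \<delta> p \<le> d\<^sub>2) \<longrightarrow>
        (\<forall>(a :: nat \<Rightarrow> nat) (C\<^sub>1 :: real) (C\<^sub>2 :: real).
           2 \<le> C\<^sub>1 \<and> C\<^sub>1 \<le> C\<^sub>2
         \<and> (\<forall>j\<ge>1. C\<^sub>1 \<le> real (a (j + 1)) - real (a j) \<and> real (a (j + 1)) - real (a j) \<le> C\<^sub>2)
         \<and> 2 \<le> d\<^sub>1 * C\<^sub>1 * (1 + C\<^sub>1)
         \<and> 1 + d\<^sub>2 * C\<^sub>2 * (C\<^sub>2 - 1) / 2 \<le> d\<^sub>1 * C\<^sub>1 * (C\<^sub>1 - 1)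
         \<longrightarrow> lusky_numbers M a))"
proof -
  define S where "S n = (\<Sum>j=1..n. \<delta> j)" for n
  have S_Suc: "S (Suc n) = S n + \<delta> (Suc n)" for n
    by (simp add: S_def)
  interpret log_quotients S M
  proof
    show "mono S"
      by (rule mono_iff_le_Suc[THEN iffD2]) (simp add: S_Suc delta_nonneg)
    show "filterlim S at_top sequentially"
      using delta_diverges by (simp add: S_def[abs_def])
  qed (simp_all add: S_def M_eq)

  have delta_eq: "\<delta> p = S (Suc (p - 1)) - S (p - 1)" if "p \<ge> 1" for p
    using that S_Suc[of "p - 1"] by simp
  have part_i: "\<not> moderate_growth M \<and> \<not> (\<exists>a. (\<forall>j\<ge>1. a j > 0) \<and> lusky_numbers M a)"
    if unbounded: "(SUP p\<in>{1..}. ereal (\<delta> p)) = \<infinity>"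
  proof -
    have "\<not> (\<exists>C. \<forall>n. S (Suc n) - S n \<le> C)"
    proof
      assume "\<exists>C. \<forall>n. S (Suc n) - S n \<le> C"
      then have "\<exists>C. \<forall>p\<in>{1..}. \<delta> p \<le> C"
        using delta_eq by (metis atLeast_iff)
      with unbounded show False
        using SUP_ereal_less_infinity_iff[of \<delta> "{1..}"] by simp
    qed
    then show ?thesis
      using increments_bounded_if_moderate_growth increments_bounded_if_lusky_numbers by blast
  qed

  have gaps_iff: "(SUP j\<in>{1..}. ereal (real (a (j + 1)) - real (a j))) < \<infinity> \<longleftrightarrow>
      (\<exists>C. \<forall>j\<ge>1. real (a (j + 1)) - real (a j) \<le> C)" for a :: "nat \<Rightarrow> nat"
    unfolding SUP_ereal_less_infinity_iff by (simp add: Ball_def)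
  have gaps_iff_two: "(SUP j\<in>{1..}. ereal (real (a (j + 1)) - real (a j))) < \<infinity> \<longleftrightarrow>
      (\<exists>C::real. C \<ge> 2 \<and>
         (\<forall>j\<ge>1. 2 \<le> real (a (j + 1)) - real (a j) \<and> real (a (j + 1)) - real (a j) \<le> C))"
    if lusky: "lusky_numbers M a" for a
  proof -
    have "2 \<le> real (a (j + 1)) - real (a j)" if "j \<ge> 1" for j
      using lusky_numbers_gap_ge_2[OF lusky that] by linarith
    then show ?thesis
      unfolding gaps_iff by (meson order_trans order_refl)
  qed
  have gaps_iff_solid: "(SUP j\<in>{1..}. ereal (real (a (j + 1)) - real (a j))) < \<infinity> \<longleftrightarrow>
      solid (taylor_coeffs ` H_infty (weight M c))"
    if lusky: "lusky_numbers M a" and "c > 0" for a c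
  proof -
    have "(\<exists>C. \<forall>j\<ge>1. real (a (j + 1)) - real (a j) \<le> C) \<longleftrightarrow> (\<exists>L. \<forall>j\<ge>1. a (j + 1) \<le> a j + L)"
    proof
      assume "\<exists>C. \<forall>j\<ge>1. real (a (j + 1)) - real (a j) \<le> C"
      then obtain C where C: "\<forall>j\<ge>1. real (a (j + 1)) - real (a j) \<le> C" ..
      have "a (j + 1) \<le> a j + nat \<lceil>C\<rceil>" if "j \<ge> 1" for j
      proof -
        have "real (a (j + 1)) - real (a j) \<le> C" using C that by blast
        then show ?thesis using real_nat_ceiling_ge[of C] by linarith
      qed
      then show "\<exists>L. \<forall>j\<ge>1. a (j + 1) \<le> a j + L" by blast
    next
      assume "\<exists>L. \<forall>j\<ge>1. a (j + 1) \<le> a j + L"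
      then obtain L where L: "\<forall>j\<ge>1. a (j + 1) \<le> a j + L" ..
      have "real (a (j + 1)) - real (a j) \<le> real L" if "j \<ge> 1" for j
      proof -
        have "a (j + 1) \<le> a j + L" using L that by blast
        then show ?thesis by linarith
      qed
      then show "\<exists>C. \<forall>j\<ge>1. real (a (j + 1)) - real (a j) \<le> C" by blast
    qed
    then show ?thesis
      unfolding gaps_iff solid_iff_bounded_gaps[OF \<open>c > 0\<close> lusky] .
  qed
  have last_increment: "(SUP j\<in>{1..}. ereal (\<delta> (a (j + 1) + 1) * (real (a (j + 1)) - real (a j)))) < \<infinity>"
    if lusky: "lusky_numbers M a" for a
    using last_increment_times_gap_bounded[OF lusky]
    unfolding SUP_ereal_less_infinity_iff by (simp add: S_Suc Ball_def)
  have eventually_ge: "\<exists>\<epsilon>>0. \<exists>N. \<forall>n\<ge>N. \<epsilon> \<le> S (Suc n) - S n"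
    if liminf: "liminf (\<lambda>p. ereal (\<delta> p)) > 0"
  proof -
    obtain \<epsilon> where \<epsilon>: "0 < ereal \<epsilon>" "ereal \<epsilon> < liminf (\<lambda>p. ereal (\<delta> p))"
      using ereal_dense2[OF liminf] by blast
    then obtain N where "\<forall>p\<ge>N. ereal \<epsilon> < ereal (\<delta> p)"
      using less_LiminfD eventually_sequentially by metis
    then have "\<forall>n\<ge>N. \<epsilon> \<le> S (Suc n) - S n"
      by (simp add: S_Suc less_imp_le)
    with \<epsilon> show ?thesis by auto
  qed
  have gaps_finite: "(SUP j\<in>{1..}. ereal (real (a (j + 1)) - real (a j))) < \<infinity>"
    if liminf: "liminf (\<lambda>p. ereal (\<delta> p)) > 0" and lusky: "lusky_numbers M a" for a
  proof -
    obtain \<epsilon> N where "\<epsilon> > 0" "\<And>n. n \<ge> N \<Longrightarrow> \<epsilon> \<le> S (Suc n) - S n"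
      using eventually_ge[OF liminf] by blast
    then show ?thesis
      unfolding gaps_iff by (rule gaps_bounded_if_increments_eventually_ge[OF lusky])
  qed
  have solid: "solid (taylor_coeffs ` H_infty (weight M c))"
    if liminf: "liminf (\<lambda>p. ereal (\<delta> p)) > 0" and "c > 0" for c
  proof -
    obtain \<epsilon> N where "\<epsilon> > 0" "\<And>n. n \<ge> N \<Longrightarrow> \<epsilon> \<le> S (Suc n) - S n"
      using eventually_ge[OF liminf] by blast
    then show ?thesis
      by (rule solid_if_separated[OF \<open>c > 0\<close> _ separated_if_increments_eventually_ge])
  qed

  have part_iii: "lusky_numbers M a"
    if "0 < d1 \<and> d1 \<le> d2 \<and> (\<forall>p\<ge>1. d1 \<le> \<delta> p \<and> \<delta> p \<le> d2)"
      and a: "2 \<le> C1 \<and> C1 \<le> C2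
         \<and> (\<forall>j\<ge>1. C1 \<le> real (a (j + 1)) - real (a j) \<and> real (a (j + 1)) - real (a j) \<le> C2)
         \<and> 2 \<le> d1 * C1 * (1 + C1)
         \<and> 1 + d2 * C2 * (C2 - 1) / 2 \<le> d1 * C1 * (C1 - 1)"
    for d1 d2 C1 C2 :: real and a :: "nat \<Rightarrow> nat"
  proof (rule lusky_numbers_if_increments_between[where ?d1.0 = d1 and ?d2.0 = d2 and ?C1.0 = C1 and ?C2.0 = C2])
    \<comment> \<open>With \<open>x = d1 * C1 * (C1 - 1)\<close> the hypothesis on \<open>C2\<close> now yields \<open>1 + x / 2 \<le> x\<close>, so \<open>x \<ge> 2\<close>.\<close>
    have "d1 * (C1 * (C1 - 1)) \<le> d2 * (C2 * (C2 - 1))"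
      using that by (intro mult_mono) auto
    then show "2 \<le> d1 * C1 * (C1 - 1)"
      using a by (simp add: mult.assoc)
  qed (use that in \<open>auto simp: S_Suc\<close>)

  show ?thesis
    by (intro conjI impI allI)
      (rule M_in_LC
        | (rule part_i[THEN conjunct1] part_i[THEN conjunct2] last_increment gaps_iff_two
             gaps_iff_solid gaps_finite solid part_iii, assumption+)
        | (rule gaps_iff_two[THEN iffD1, OF _ gaps_finite], assumption+))+
qed

end
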